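(* Assume that $\mathbb{P}(\lim_{|j|\to\infty}|\boldsymbol Y_j|=0)=1$. Let $H$ be a shift invariant, $\alpha$-homogeneous measurable function defined on a subset $\mathcal{O}$ of $\ell_\alpha$ such that $\mathbb{P}(\boldsymbol\Theta_{n,\infty}\in\mathcal{O})=1$ for all $n\in\mathbb{Z}$. Assume moreover (i) $\mathbb{E}[|H(\boldsymbol\Theta_{0,\infty})-H(\boldsymbol\Theta_{1,\infty})|]<\infty$; (ii) $\mathbb{P}(\lim_{n\to\infty}H(\boldsymbol\Theta_{n,\infty})=0)=1$; (iii) $\mathbb{P}(\lim_{n\to\infty}H(\boldsymbol\Theta_{-n,\infty})=H(\boldsymbol\Theta))=1$. Then $\mathbb{E}[|H(\boldsymbol Q)|]<\infty$ and $$\vartheta\,\mathbb{E}[H(\boldsymbol Q)]=\mathbb{E}\left[H(\boldsymbol\Theta_{0,\infty})-H(\boldsymbol\Theta_{1,\infty})\right].$$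
   Context: Let $|\cdot|$ be an arbitrary norm on $\mathbb{R}^d$. Let $\{\boldsymbol X_j,j\in\mathbb{Z}\}$ be a stationary $\mathbb{R}^d$-valued time series which is regularly varying: for all integers $s\le t$ there is a non-zero Radon measure $\nu_{s,t}$ on $(\mathbb{R}^d)^{[s,t]}\setminus\{\boldsymbol 0\}$ such that $\mathbb{P}(u^{-1}(\boldsymbol X_s,\dots,\boldsymbol X_t)\in\cdot)/\mathbb{P}(|\boldsymbol X_0|>u)\to\nu_{s,t}$ vaguely as $u\to\infty$. Let $\alpha>0$ be its tail index. The tail process is the random sequence $\boldsymbol Y=\{\boldsymbol Y_j,j\in\mathbb{Z}\}$ with $\mathbb{P}(|\boldsymbol Y_0|>y)=y^{-\alpha}$ for $y\ge1$ and such that, for all $s\le t$, the law of $u^{-1}(\boldsymbol X_s,\dots,\boldsymbol X_t)$ conditionally on $|\boldsymbol X_0|>u$ converges weakly to that of $(\boldsymbol Y_s,\dots,\boldsymbol Y_t)$ as $u\to\infty$. The spectral tail process is $\boldsymbol\Theta=\{\boldsymbol\Theta_j,j\in\mathbb{Z}\}$ with $\boldsymbol\Theta_j=\boldsymbol Y_j/|\boldsymbol Y_0|$; it is independent of $|\boldsymbol Y_0|$. Notation: $\ell_\alpha=\{\boldsymbol x\in(\mathbb{R}^d)^{\mathbb{Z}}:\sum_{j\in\mathbb{Z}}|\boldsymbol x_j|^\alpha<\infty\}$. $\boldsymbol x_{n,\infty}$ is the sequence $(\boldsymbol x_n,\boldsymbol x_{n+1},\dots)$ identified with the element of $(\mathbb{R}^d)^{\mathbb{Z}}$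 whose coordinates of index $<n$ are set to zero (the others being unchanged). $B$ is the backshift, $(B\boldsymbol x)_j=\boldsymbol x_{j-1}$. A function $H$ is shift invariant if $H(B\boldsymbol x)=H(\boldsymbol x)$, and $\alpha$-homogeneous if $H(t\boldsymbol x)=t^\alpha H(\boldsymbol x)$ for all $t>0$. For $-\infty\le s\le t\le\infty$, $\boldsymbol y^*_{s,t}=\max_{s\le i\le t}|\boldsymbol y_i|$ and $\boldsymbol y^*=\max_{i\in\mathbb{Z}}|\boldsymbol y_i|$ (understood as suprema in $[0,\infty]$). The candidate extremal index is $\vartheta=\mathbb{P}(\sup_{j\ge1}|\boldsymbol Y_j|\le1)$, which also equals $\mathbb{P}(\sup_{j\le-1}|\boldsymbol Y_j|\le1)$; when $\mathbb{P}(\lim_{|k|\to\infty}|\boldsymbol Y_k|=0)=1$, one has $\vartheta>0$. In that case $\boldsymbol Q=\{\boldsymbol Q_j,j\in\mathbb{Z}\}$ denotes a random sequence whose distribution is that of $(\boldsymbol Y^* )^{-1}\boldsymbol Y$ conditionally on $\boldsymbol Y^*_{-\infty,-1}\le1$. *)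

theory Defs
  imports "HOL-Probability.Probability"
begin

text \<open>
  Sequences are functions \<open>int \<Rightarrow> real ^ 'd\<close>. This type carries the product topology, and
  as the index set is countable its Borel sigma-algebra \<open>borel\<close> is the product sigma-algebra,
  so a random sequence (time series) is a Borel measurable map into this type.
\<close>

definition is_norm :: "('a::real_vector \<Rightarrow> real) \<Rightarrow> bool" where
  "is_norm nrm \<longleftrightarrow>
     (\<forall>x. nrm x = 0 \<longleftrightarrow> x = 0) \<and>
     (\<forall>c x. nrm (c *\<^sub>R x) = \<bar>c\<bar> * nrm x) \<and>
     (\<forall>x y. nrm (x + y) \<le> nrm x + nrm y)"


subsection \<open>Sequences\<close>

definition seq_scale :: "real \<Rightarrow> (int \<Rightarrow> 'a::real_vector) \<Rightarrow> int \<Rightarrow> 'a" where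
  "seq_scale c x = (\<lambda>j. c *\<^sub>R x j)"

definition backshift :: "(int \<Rightarrow> 'a) \<Rightarrow> int \<Rightarrow> 'a" where
  "backshift x = (\<lambda>j. x (j - 1))"

text \<open>\<open>future n x\<close> is \<open>(x\<^sub>n, x\<^sub>n\<^sub>+\<^sub>1, \<dots>)\<close>, extended by zero to the indices below \<open>n\<close>.\<close>

definition future :: "int \<Rightarrow> (int \<Rightarrow> 'a::zero) \<Rightarrow> int \<Rightarrow> 'a" where
  "future n x = (\<lambda>j. if n \<le> j then x j else 0)"

definition ell :: "('a \<Rightarrow> real) \<Rightarrow> real \<Rightarrow> (int \<Rightarrow> 'a) set" where
  "ell nrm \<alpha> = {x. (\<lambda>j. nrm (x j) powr \<alpha>) summable_on UNIV}"

text \<open>Suprema of norms are taken in \<open>[0, \<infinity>]\<close>.\<close>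

definition seq_sup :: "('a \<Rightarrow> real) \<Rightarrow> int set \<Rightarrow> (int \<Rightarrow> 'a) \<Rightarrow> ennreal" where
  "seq_sup nrm J x = (SUP j\<in>J. ennreal (nrm (x j)))"

text \<open>
  The equations \<open>H (B x) = H x\<close> and \<open>H (t x) = t\<^sup>\<alpha> H x\<close> for a function defined on \<open>D\<close> are
  equations between partial functions: one side is defined iff the other is.
\<close>

definition shift_invariant_on :: "(int \<Rightarrow> 'a) set \<Rightarrow> ((int \<Rightarrow> 'a) \<Rightarrow> real) \<Rightarrow> bool" where
  "shift_invariant_on D H \<longleftrightarrow>
     (\<forall>x. backshift x \<in> D \<longleftrightarrow> x \<in> D) \<and> (\<forall>x\<in>D. H (backshift x) = H x)"

definition homogeneous_on ::
    "real \<Rightarrow> (int \<Rightarrow> 'a::real_vector) set \<Rightarrow> ((int \<Rightarrow> 'a) \<Rightarrow> real) \<Rightarrow> bool" where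
  "homogeneous_on \<alpha> D H \<longleftrightarrow>
     (\<forall>t>0. (\<forall>x. seq_scale t x \<in> D \<longleftrightarrow> x \<in> D) \<and>
            (\<forall>x\<in>D. H (seq_scale t x) = t powr \<alpha> * H x))"


subsection \<open>Weak and vague convergence\<close>

text \<open>
  Both notions are for families of measures on the Borel sets of a subspace \<open>T\<close> of a
  topological space.
\<close>

definition weakly_tendsto_on ::
    "'a::topological_space set \<Rightarrow> ('i \<Rightarrow> 'a measure) \<Rightarrow> 'a measure \<Rightarrow> 'i filter \<Rightarrow> bool" where
  "weakly_tendsto_on T \<mu> \<mu>' F \<longleftrightarrow>
     (\<forall>f::'a \<Rightarrow> real. continuous_on T f \<and> bounded (f ` T) \<longrightarrow>
        ((\<lambda>i. LINT x:T|\<mu> i. f x) \<longlongrightarrow> (LINT x:T|\<mu>'. f x)) F)"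

definition vaguely_tendsto_on ::
    "'a::topological_space set \<Rightarrow> ('i \<Rightarrow> 'a measure) \<Rightarrow> 'a measure \<Rightarrow> 'i filter \<Rightarrow> bool" where
  "vaguely_tendsto_on T \<mu> \<mu>' F \<longleftrightarrow>
     (\<forall>f::'a \<Rightarrow> real. continuous_on T f \<and> (\<exists>K. compact K \<and> K \<subseteq> T \<and> (\<forall>x\<in>T - K. f x = 0)) \<longrightarrow>
        ((\<lambda>i. LINT x:T|\<mu> i. f x) \<longlongrightarrow> (LINT x:T|\<mu>'. f x)) F)"

text \<open>
  For locally compact, second countable Hausdorff \<open>T\<close> (as below) a Borel measure that is
  finite on compact sets is automatically regular.
\<close>

definition radon_on :: "'a::topological_space set \<Rightarrow> 'a measure \<Rightarrow> bool" where
  "radon_on T \<nu> \<longleftrightarrow>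
     sets \<nu> = sets (restrict_space borel T) \<and> (\<forall>K. compact K \<and> K \<subseteq> T \<longrightarrow> emeasure \<nu> K < \<infinity>)"


subsection \<open>Regular variation and the tail process\<close>

definition stationary :: "'w measure \<Rightarrow> ('w \<Rightarrow> int \<Rightarrow> 'a::topological_space) \<Rightarrow> bool" where
  "stationary M X \<longleftrightarrow> (\<forall>h. distr M borel (\<lambda>\<omega> j. X \<omega> (j + h)) = distr M borel X)"

text \<open>
  The space of blocks indexed by \<open>{s..t}\<close>, as extensional functions; as a subspace of
  \<open>int \<Rightarrow> 'a\<close> it is homeomorphic to the finite power.
\<close>

definition blocks :: "int \<Rightarrow> int \<Rightarrow> (int \<Rightarrow> 'a) set" where
  "blocks s t = {s..t} \<rightarrow>\<^sub>E UNIV"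

definition blocks0 :: "int \<Rightarrow> int \<Rightarrow> (int \<Rightarrow> 'a::zero) set" where
  "blocks0 s t = blocks s t - {restrict (\<lambda>_. 0) {s..t}}"

definition block_law ::
    "'w measure \<Rightarrow> ('w \<Rightarrow> int \<Rightarrow> 'a::topological_space) \<Rightarrow> int \<Rightarrow> int \<Rightarrow> (int \<Rightarrow> 'a) measure" where
  "block_law M X s t =
     distr M (restrict_space borel (blocks s t)) (\<lambda>\<omega>. restrict (X \<omega>) {s..t})"

definition exceedance ::
    "('a \<Rightarrow> real) \<Rightarrow> 'w measure \<Rightarrow> ('w \<Rightarrow> int \<Rightarrow> 'a) \<Rightarrow> real \<Rightarrow> 'w set" where
  "exceedance nrm M X u = {\<omega> \<in> space M. nrm (X \<omega> 0) > u}"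

definition regularly_varying ::
    "('a \<Rightarrow> real) \<Rightarrow> 'w measure \<Rightarrow> ('w \<Rightarrow> int \<Rightarrow> 'a::real_normed_vector) \<Rightarrow> bool" where
  "regularly_varying nrm M X \<longleftrightarrow>
     (\<forall>s t. s \<le> t \<longrightarrow>
        (\<exists>\<nu>. radon_on (blocks0 s t) \<nu> \<and> emeasure \<nu> (blocks0 s t) \<noteq> 0 \<and>
             vaguely_tendsto_on (blocks0 s t)
               (\<lambda>u. scale_measure (1 / emeasure M (exceedance nrm M X u))
                      (restrict_space
                        (block_law M (\<lambda>\<omega>. seq_scale (1 / u) (X \<omega>)) s t) (blocks0 s t)))
               \<nu> at_top))"

definition tail_index ::
    "('a \<Rightarrow> real) \<Rightarrow> 'w measure \<Rightarrow> ('w \<Rightarrow> int \<Rightarrow> 'a) \<Rightarrow> real \<Rightarrow> bool" where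
  "tail_index nrm M X \<alpha> \<longleftrightarrow>
     (\<forall>y>0. ((\<lambda>u. measure M (exceedance nrm M X (u * y)) / measure M (exceedance nrm M X u))
               \<longlongrightarrow> y powr (- \<alpha>)) at_top)"

definition tail_process ::
    "('a \<Rightarrow> real) \<Rightarrow> real \<Rightarrow> 'w measure \<Rightarrow> ('w \<Rightarrow> int \<Rightarrow> 'a::real_normed_vector) \<Rightarrow>
     'v measure \<Rightarrow> ('v \<Rightarrow> int \<Rightarrow> 'a) \<Rightarrow> bool" where
  "tail_process nrm \<alpha> M X N Y \<longleftrightarrow>
     (\<forall>y\<ge>1. measure N (exceedance nrm N Y y) = y powr (- \<alpha>)) \<and>
     (\<forall>s t. s \<le> t \<longrightarrow>
        weakly_tendsto_on (blocks s t)
          (\<lambda>u. block_law (uniform_measure M (exceedance nrm M X u))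
                 (\<lambda>\<omega>. seq_scale (1 / u) (X \<omega>)) s t)
          (block_law N Y s t) at_top)"

definition spectral :: "('a \<Rightarrow> real) \<Rightarrow> (int \<Rightarrow> 'a::real_vector) \<Rightarrow> int \<Rightarrow> 'a" where
  "spectral nrm y = seq_scale (1 / nrm (y 0)) y"

definition extremal_index :: "('a \<Rightarrow> real) \<Rightarrow> 'v measure \<Rightarrow> ('v \<Rightarrow> int \<Rightarrow> 'a) \<Rightarrow> real" where
  "extremal_index nrm N Y = measure N {\<omega> \<in> space N. seq_sup nrm {1..} (Y \<omega>) \<le> 1}"

text \<open>
  The law of \<open>Y / Y\<^sup>*\<close> conditionally on \<open>Y\<^sup>*\<^bsub>-\<infinity>,-1\<^esub> \<le> 1\<close>. The value given to \<open>Y / Y\<^sup>*\<close> when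
  \<open>Y\<^sup>*\<close> is \<open>0\<close> or \<open>\<infinity>\<close> is the zero sequence; when \<open>Y\<close> is a tail process that vanishes at
  infinity almost surely, this is a null event.
\<close>

definition Q_law ::
    "('a \<Rightarrow> real) \<Rightarrow> 'v measure \<Rightarrow> ('v \<Rightarrow> int \<Rightarrow> 'a::real_normed_vector) \<Rightarrow> (int \<Rightarrow> 'a) measure" where
  "Q_law nrm N Y =
     distr (uniform_measure N {\<omega> \<in> space N. seq_sup nrm {..-1} (Y \<omega>) \<le> 1}) borel
       (\<lambda>\<omega>. seq_scale (1 / enn2real (seq_sup nrm UNIV (Y \<omega>))) (Y \<omega>))"

end

theory Submission
  imports Defs
begin

text \<open>
  Suppose first that \<open>K\<close> is a nonnegative \<open>\<alpha>\<close>-homogeneous functional with \<open>K(x) = 0\<close> whenever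
  \<open>x\<^sub>0 = 0\<close>. The identity that carries the proof is (lemma \<open>nn_integral_orbit_sum\<close>)
  \<open>E[K(\<Theta>)] = E[(\<Sum>j. K(shift\<^sub>j Y / Y\<^sup>*)) 1{Y\<^sup>*\<^bsub>-\<infinity>,-1\<^esub> \<le> 1}]\<close>, whose right-hand side is
  \<open>\<vartheta> E[\<Sum>j. K(shift\<^sub>j Q)]\<close>. It is a mass transport principle for the following reason. Given
  \<open>\<Theta>\<close>, the event \<open>Y\<^sup>*\<^bsub>-\<infinity>,-1\<^esub> \<le> 1\<close> has probability
  \<open>(\<Theta>\<^sup>*\<^bsub>-\<infinity>,0\<^esub>)\<^sup>\<alpha> - (\<Theta>\<^sup>*\<^bsub>-\<infinity>,-1\<^esub>)\<^sup>\<alpha>\<close>, because \<open>|Y\<^sub>0|\<close> is Pareto distributed and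
  independent of \<open>\<Theta>\<close> (\<open>polar_le\<close>). After normalization by \<open>(\<Theta>\<^sup>*)\<^sup>\<alpha>\<close> this is a scale invariant
  weight, and the time change formula (\<open>spectral_time_change\<close>) lets the shift act on this weight
  instead of on \<open>K\<close>. The shifted weights are the increments of the running supremum of
  \<open>|\<Theta>\<^sub>i|\<^sup>\<alpha>\<close> relative to its final value, so they sum to \<open>1\<close> and only \<open>E[K(\<Theta>)]\<close> is left.

  Two choices of \<open>K\<close> give the result. With the decrease at time \<open>0\<close> of the power \<open>\<alpha>\<close> of the
  supremum over the future, the orbit sum is \<open>(x\<^sup>*)\<^sup>\<alpha>\<close>, and the identity says that the probability of no exceedance
  after time \<open>0\<close> equals the probability of none before it (\<open>extremal_index_eq\<close>). With the positive and
  negative parts of \<open>H(x\<^bsub>0,\<infinity>\<^esub>) - H(x\<^bsub>1,\<infinity>\<^esub>)\<close>, shift invariance makes the orbit sum telescope, and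
  hypotheses (ii) and (iii), which pass from \<open>\<Theta>\<close> to its multiple \<open>Y / Y\<^sup>*\<close> by homogeneity, say that
  it telescopes to \<open>H(x)\<close>; hypothesis (i) makes both parts integrable.

  The time change formula (\<open>time_change\<close>) and the independence of \<open>|Y\<^sub>0|\<close> and \<open>\<Theta>\<close> are derived from the
  definition of the tail process as a weak limit. Stationarity of \<open>X\<close> relates the conditional
  laws given \<open>|X\<^sub>0| > u\<close> and given \<open>|X\<^sub>0| > u / t\<close>, and the tail index supplies the limit \<open>t\<^sup>\<alpha>\<close> of the
  ratio of the two conditioning probabilities.
\<close>

section \<open>Shifts, scalings and norms on sequence space\<close>

definition shift_seq :: "int \<Rightarrow> (int \<Rightarrow> 'a) \<Rightarrow> int \<Rightarrow> 'a" where
  "shift_seq j x = (\<lambda>i. x (i + j))"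

lemma is_norm_continuous:
  fixes nrm :: "'a::euclidean_space \<Rightarrow> real"
  assumes "is_norm nrm"
  shows "continuous_on UNIV nrm"
proof (rule convex_on_continuous)
  show "convex_on UNIV nrm"
  proof (rule convex_onI)
    fix t :: real and x y :: 'a
    assume "0 < t" "t < 1"
    then show "nrm ((1 - t) *\<^sub>R x + t *\<^sub>R y) \<le> (1 - t) * nrm x + t * nrm y"
      using assms unfolding is_norm_def by (metis abs_of_pos diff_gt_0_iff_gt)
  qed simp
qed simp

lemma continuous_seq_scale [continuous_intros]:
  fixes f :: "'b::topological_space \<Rightarrow> int \<Rightarrow> 'a::real_normed_vector"
  assumes "continuous_on S f"
  shows "continuous_on S (\<lambda>x. seq_scale c (f x))"
  unfolding seq_scale_def
  by (intro continuous_intros continuous_on_product_then_coordinatewise[OF assms])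

lemma continuous_shift [continuous_intros]:
  fixes f :: "'b::topological_space \<Rightarrow> int \<Rightarrow> 'a::topological_space"
  assumes "continuous_on S f"
  shows "continuous_on S (\<lambda>x. shift_seq j (f x))"
  unfolding shift_seq_def
  by (intro continuous_intros continuous_on_product_then_coordinatewise[OF assms])

lemma measurable_seq_scale [measurable (raw)]:
  fixes f :: "'b \<Rightarrow> int \<Rightarrow> 'a::euclidean_space"
  assumes [measurable]: "f \<in> borel_measurable M" "c \<in> borel_measurable M"
  shows "(\<lambda>x. seq_scale (c x) (f x)) \<in> borel_measurable M"
  unfolding seq_scale_def
  using measurable_product_then_coordinatewise[OF assms(1)]
  by (intro measurable_coordinatewise_then_product borel_measurable_scaleR) measurable

lemma measurable_shift [measurable (raw)]:
  fixes f :: "'b \<Rightarrow> int \<Rightarrow> 'a::euclidean_space"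
  assumes [measurable]: "f \<in> borel_measurable M"
  shows "(\<lambda>x. shift_seq j (f x)) \<in> borel_measurable M"
  unfolding shift_seq_def
proof (rule measurable_coordinatewise_then_product)
  fix i
  show "(\<lambda>x. f x (i + j)) \<in> borel_measurable M"
    using measurable_product_then_coordinatewise[OF assms, of "i + j"] .
qed

text \<open>
  Lets weak convergence of block laws be used with test functions on whole sequences: a function of
  the coordinates \<open>s..t\<close> does not see that a block is \<open>undefined\<close> elsewhere.
\<close>

lemma integral_block_law:
  fixes f :: "(int \<Rightarrow> 'a::euclidean_space) \<Rightarrow> real"
  assumes [measurable]: "Z \<in> borel_measurable P" "f \<in> borel_measurable borel"
    and local: "\<And>x. f (restrict x {s..t}) = f x"
  shows "(LINT x:blocks s t|block_law P Z s t. f x) = (LINT \<omega>|P. f (Z \<omega>))"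
proof -
  have "(\<lambda>\<omega>. restrict (Z \<omega>) {s..t}) \<in> borel_measurable P"
    unfolding restrict_def
    by (rule measurable_coordinatewise_then_product)
       (use measurable_product_then_coordinatewise[OF assms(1)] in simp)
  then have meas: "(\<lambda>\<omega>. restrict (Z \<omega>) {s..t}) \<in> measurable P (restrict_space borel (blocks s t))"
    by (rule measurable_restrict_space2[rotated]) (auto simp: blocks_def)
  have "(LINT x:blocks s t|block_law P Z s t. f x) = (LINT x|block_law P Z s t. f x)"
    unfolding set_lebesgue_integral_def
    by (rule Bochner_Integration.integral_cong) (auto simp: block_law_def space_restrict_space)
  also have "\<dots> = (LINT \<omega>|P. f (restrict (Z \<omega>) {s..t}))"
    unfolding block_law_def by (rule integral_distr[OF meas]) (simp add: measurable_restrict_space1)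
  finally show ?thesis by (simp add: local)
qed

section \<open>Time change for continuous test functions\<close>

text \<open>
  The data behind the tail process. The time change formula and its consequences hold for
  every tail process; that the process vanishes at infinity is added only where its suprema enter.
\<close>

locale tail_process_of_stationary =
  fixes nrm :: "'a::euclidean_space \<Rightarrow> real" and \<alpha> :: real
    and M :: "'w measure" and X :: "'w \<Rightarrow> int \<Rightarrow> 'a"
    and N :: "'v measure" and Y :: "'v \<Rightarrow> int \<Rightarrow> 'a"
  assumes nrm: "is_norm nrm"
    and prob_M: "prob_space M" and X [measurable]: "X \<in> borel_measurable M"
    and stat: "stationary M X"
    and \<alpha>: "\<alpha> > 0" and index: "tail_index nrm M X \<alpha>"
    and prob_N: "prob_space N" and Y [measurable]: "Y \<in> borel_measurable N"
    and tail: "tail_process nrm \<alpha> M X N Y"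
begin

sublocale M: prob_space M by (rule prob_M)
sublocale N: prob_space N by (rule prob_N)

lemma nrm_continuous: "continuous_on S nrm"
  using continuous_on_subset[OF is_norm_continuous[OF nrm]] by blast

lemma nrm_measurable [measurable]: "nrm \<in> borel_measurable borel"
  by (rule borel_measurable_continuous_onI[OF nrm_continuous])

lemma nrm_scale [simp]: "nrm (c *\<^sub>R x) = \<bar>c\<bar> * nrm x"
  using nrm by (simp add: is_norm_def)

lemma nrm_eq_0 [simp]: "nrm x = 0 \<longleftrightarrow> x = 0"
  using nrm by (simp add: is_norm_def)

lemma nrm_0 [simp]: "nrm 0 = 0"
  by (subst nrm_eq_0) simp

lemma nrm_nonneg [simp]: "0 \<le> nrm x"
proof -
  have "nrm (x + (-1) *\<^sub>R x) \<le> nrm x + nrm ((-1) *\<^sub>R x)"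
    using nrm unfolding is_norm_def by blast
  also have "nrm ((-1) *\<^sub>R x) = nrm x" by (subst nrm_scale) simp
  finally have "nrm 0 \<le> 2 * nrm x" by simp
  then show ?thesis by simp
qed

lemma coordinate_measurable [measurable]:
  "(\<lambda>\<omega>. X \<omega> i) \<in> borel_measurable M" "(\<lambda>\<omega>. Y \<omega> i) \<in> borel_measurable N"
  using measurable_product_then_coordinatewise[OF X] measurable_product_then_coordinatewise[OF Y]
  by auto

lemma exceedance_sets [measurable]:
  "exceedance nrm M X u \<in> sets M" "exceedance nrm N Y u \<in> sets N"
  unfolding exceedance_def by measurable

lemma exceedance_pos: "eventually (\<lambda>u. measure M (exceedance nrm M X u) > 0) at_top"
proof -
  \<comment> \<open>A zero denominator would make the quotient \<open>0\<close>, so a quotient with limit \<open>1\<close> has positive denominators.\<close>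
  have "((\<lambda>u. measure M (exceedance nrm M X (u * 1)) / measure M (exceedance nrm M X u))
               \<longlongrightarrow> 1 powr (- \<alpha>)) at_top"
    using index unfolding tail_index_def by (meson zero_less_one)
  then have "eventually (\<lambda>u. measure M (exceedance nrm M X (u * 1)) / measure M (exceedance nrm M X u) > 0) at_top"
    by (rule order_tendstoD) simp
  then show ?thesis
    by eventually_elim (auto simp: zero_less_measure_iff split: if_splits)
qed

text \<open>
  For a test function that vanishes off \<open>{|x\<^sub>0| > 1}\<close>, conditioning on the exceedance
  \<open>|X\<^sub>0| > u\<close> amounts to dividing the unconditional expectation by its probability. Only in the
  unconditional form can stationarity be used.
\<close>

lemma tail_process_limit:
  fixes f :: "(int \<Rightarrow> 'a) \<Rightarrow> real"
  assumes cont: "continuous_on UNIV f" and bdd: "bounded (range f)"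
    and local: "\<And>x. f (restrict x {s..t}) = f x" and "s \<le> t"
    and vanish: "\<And>x. nrm (x 0) \<le> 1 \<Longrightarrow> f x = 0"
  shows "((\<lambda>u. (LINT \<omega>|M. f (seq_scale (1 / u) (X \<omega>))) / measure M (exceedance nrm M X u))
            \<longlongrightarrow> (LINT \<omega>|N. f (Y \<omega>))) at_top"
proof -
  have f [measurable]: "f \<in> borel_measurable borel"
    by (rule borel_measurable_continuous_onI[OF cont])
  let ?E = "exceedance nrm M X"
  let ?\<mu> = "\<lambda>u. uniform_measure M (?E u)"
  have "weakly_tendsto_on (blocks s t)
          (\<lambda>u. block_law (?\<mu> u) (\<lambda>\<omega>. seq_scale (1 / u) (X \<omega>)) s t)
          (block_law N Y s t) at_top"
    using tail \<open>s \<le> t\<close> by (simp add: tail_process_def)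
  then have "((\<lambda>u. LINT x:blocks s t|block_law (?\<mu> u) (\<lambda>\<omega>. seq_scale (1 / u) (X \<omega>)) s t. f x)
      \<longlongrightarrow> (LINT x:blocks s t|block_law N Y s t. f x)) at_top"
    unfolding weakly_tendsto_on_def
    using continuous_on_subset[OF cont, of "blocks s t"] bounded_subset[OF bdd, of "f ` blocks s t"]
    by auto
  also have "(\<lambda>u. LINT x:blocks s t|block_law (?\<mu> u) (\<lambda>\<omega>. seq_scale (1 / u) (X \<omega>)) s t. f x)
      = (\<lambda>u. LINT \<omega>|?\<mu> u. f (seq_scale (1 / u) (X \<omega>)))"
  proof
    fix u
    have "(\<lambda>\<omega>. seq_scale (1 / u) (X \<omega>)) \<in> borel_measurable (?\<mu> u)"
      by (simp add: measurable_seq_scale)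
    then show "(LINT x:blocks s t|block_law (?\<mu> u) (\<lambda>\<omega>. seq_scale (1 / u) (X \<omega>)) s t. f x)
      = (LINT \<omega>|?\<mu> u. f (seq_scale (1 / u) (X \<omega>)))"
      by (rule integral_block_law[OF _ f local])
  qed
  also have "(LINT x:blocks s t|block_law N Y s t. f x) = (LINT \<omega>|N. f (Y \<omega>))"
    by (rule integral_block_law[OF Y f local])
  finally have lim: "((\<lambda>u. LINT \<omega>|?\<mu> u. f (seq_scale (1 / u) (X \<omega>)))
     \<longlongrightarrow> (LINT \<omega>|N. f (Y \<omega>))) at_top" .
  have "eventually (\<lambda>u. (LINT \<omega>|?\<mu> u. f (seq_scale (1 / u) (X \<omega>)))
        = (LINT \<omega>|M. f (seq_scale (1 / u) (X \<omega>))) / measure M (?E u)) at_top"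
    using exceedance_pos eventually_gt_at_top[of 0]
  proof eventually_elim
    case (elim u)
    have "?\<mu> u = density M (\<lambda>\<omega>. ennreal (indicator (?E u) \<omega> / measure M (?E u)))"
      unfolding uniform_measure_def using elim
      by (intro density_cong) (auto simp: M.emeasure_eq_measure divide_ennreal indicator_def simp flip: ennreal_1)
    then have "(LINT \<omega>|?\<mu> u. f (seq_scale (1 / u) (X \<omega>)))
        = (LINT \<omega>|M. (indicator (?E u) \<omega> / measure M (?E u)) *\<^sub>R f (seq_scale (1 / u) (X \<omega>)))"
      by (simp add: integral_density)
    also have "\<dots> = (LINT \<omega>|M. f (seq_scale (1 / u) (X \<omega>)) / measure M (?E u))"
    proof (rule Bochner_Integration.integral_cong)
      fix \<omega> assume "\<omega> \<in> space M"
      then show "(indicator (?E u) \<omega> / measure M (?E u)) *\<^sub>R f (seq_scale (1 / u) (X \<omega>))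
        = f (seq_scale (1 / u) (X \<omega>)) / measure M (?E u)"
        using elim vanish[of "seq_scale (1 / u) (X \<omega>)"]
        by (auto simp: indicator_def exceedance_def seq_scale_def)
    qed simp
    finally show ?case by simp
  qed
  from tendsto_cong[OF this] lim show ?thesis by simp
qed

lemma integral_shift_X:
  fixes f :: "(int \<Rightarrow> 'a) \<Rightarrow> real"
  assumes [measurable]: "f \<in> borel_measurable borel"
  shows "(LINT \<omega>|M. f (shift_seq j (X \<omega>))) = (LINT \<omega>|M. f (X \<omega>))"
proof -
  have "distr M borel (\<lambda>\<omega>. shift_seq j (X \<omega>)) = distr M borel X"
    using stat unfolding stationary_def shift_seq_def by blast
  then show ?thesis
    using integral_distr[of "\<lambda>\<omega>. shift_seq j (X \<omega>)" M borel f] integral_distr[of X M borel f]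
    by simp
qed

text \<open>
  Write \<open>a(u) = E f(X / u)\<close> and \<open>p(u) = P(|X\<^sub>0| > u)\<close>. By stationarity
  \<open>E f(t B X / u) = a(u / t)\<close> for every power \<open>B\<close> of the shift. Because \<open>f\<close> vanishes unless both
  \<open>|x\<^sub>0| > 1\<close> and \<open>|x\<^sub>-\<^sub>j| > t\<close>, not only \<open>f\<close> but also \<open>x \<mapsto> f(t B x)\<close> vanishes
  off \<open>{|x\<^sub>0| > 1}\<close>, so both \<open>a(u) / p(u)\<close> and \<open>a(u / t) / p(u)\<close> converge to expectations
  under the tail process; their limits differ by the factor \<open>lim p(u / t) / p(u) = t\<^sup>\<alpha>\<close>.
\<close>

lemma time_change_continuous:
  fixes f :: "(int \<Rightarrow> 'a) \<Rightarrow> real"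
  assumes t: "t > 0" and cont: "continuous_on UNIV f" and bdd: "bounded (range f)"
    and local: "\<And>x. f (restrict x {-m..m}) = f x" and m: "\<bar>j\<bar> \<le> m"
    and vanish: "\<And>x. nrm (x 0) \<le> 1 \<or> nrm (x (-j)) \<le> t \<Longrightarrow> f x = 0"
  shows "(LINT \<omega>|N. f (seq_scale t (shift_seq j (Y \<omega>)))) = t powr \<alpha> * (LINT \<omega>|N. f (Y \<omega>))"
proof -
  have [measurable]: "f \<in> borel_measurable borel"
    by (rule borel_measurable_continuous_onI[OF cont])
  define p where "p = (\<lambda>u. measure M (exceedance nrm M X u))"
  define a where "a = (\<lambda>u. LINT \<omega>|M. f (seq_scale (1 / u) (X \<omega>)))"
  have a: "((\<lambda>u. a u / p u) \<longlongrightarrow> (LINT \<omega>|N. f (Y \<omega>))) at_top"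
    unfolding a_def p_def
    by (rule tail_process_limit[OF cont bdd local]) (use m vanish in auto)
  define g where "g = (\<lambda>x. f (seq_scale t (shift_seq j x)))"
  have g_cont: "continuous_on UNIV g"
    unfolding g_def
    by (rule continuous_on_compose2[OF cont]) (auto intro!: continuous_intros)
  have g_local: "g (restrict x {-2*m..2*m}) = g x" for x
  proof -
    have "restrict (seq_scale t (shift_seq j (restrict x {-2*m..2*m}))) {-m..m}
        = restrict (seq_scale t (shift_seq j x)) {-m..m}"
      using m by (auto simp: fun_eq_iff restrict_def seq_scale_def shift_seq_def)
    then show ?thesis unfolding g_def by (metis local)
  qed
  have g_vanish: "g x = 0" if "nrm (x 0) \<le> 1" for x
    unfolding g_def by (rule vanish) (use that t in \<open>auto simp: seq_scale_def shift_seq_def\<close>)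
  have "((\<lambda>u. (LINT \<omega>|M. g (seq_scale (1 / u) (X \<omega>))) / p u) \<longlongrightarrow> (LINT \<omega>|N. g (Y \<omega>))) at_top"
    unfolding p_def
    by (rule tail_process_limit[OF g_cont _ g_local _ g_vanish])
       (use m bdd in \<open>auto intro: bounded_subset simp: g_def\<close>)
  moreover have "(LINT \<omega>|M. g (seq_scale (1 / u) (X \<omega>))) = a (u / t)" for u
  proof -
    have "(LINT \<omega>|M. g (seq_scale (1 / u) (X \<omega>))) = (LINT \<omega>|M. f (seq_scale (t / u) (shift_seq j (X \<omega>))))"
      unfolding g_def by (simp add: seq_scale_def shift_seq_def)
    also have "\<dots> = a (u / t)"
      unfolding a_def using integral_shift_X[of "\<lambda>x. f (seq_scale (t / u) x)" j] by simp
    finally show ?thesis .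
  qed
  ultimately have "((\<lambda>u. a (u / t) / p u) \<longlongrightarrow> (LINT \<omega>|N. g (Y \<omega>))) at_top" by simp
  moreover have "((\<lambda>u. a (u / t) / p u) \<longlongrightarrow> (LINT \<omega>|N. f (Y \<omega>)) * t powr \<alpha>) at_top"
  proof -
    have div: "filterlim (\<lambda>u. u / t) at_top at_top"
      unfolding divide_inverse
      by (rule filterlim_at_top_mult_tendsto_pos[OF tendsto_const _ filterlim_ident]) (use t in simp)
    have "((\<lambda>u. p (u * (1 / t)) / p u) \<longlongrightarrow> (1 / t) powr (- \<alpha>)) at_top"
      using index t unfolding tail_index_def p_def by (auto simp del: times_divide_eq_right)
    then have "((\<lambda>u. a (u / t) / p (u / t) * (p (u / t) / p u))
        \<longlongrightarrow> (LINT \<omega>|N. f (Y \<omega>)) * (1 / t) powr (- \<alpha>)) at_top"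
      using filterlim_compose[OF a div] by (intro tendsto_mult) simp_all
    moreover have ev: "eventually (\<lambda>u. a (u / t) / p (u / t) * (p (u / t) / p u) = a (u / t) / p u) at_top"
      using filterlim_iff[THEN iffD1, OF div, rule_format, OF exceedance_pos]
      by eventually_elim (simp add: p_def)
    moreover have "(1 / t) powr (- \<alpha>) = t powr \<alpha>"
      using t by (simp add: powr_divide powr_minus_divide)
    ultimately show ?thesis using tendsto_cong[OF ev] by simp
  qed
  ultimately show ?thesis
    unfolding g_def using tendsto_unique[OF trivial_limit_at_top_linorder] by fastforce
qed

end

section \<open>Time change for measurable functionals\<close>

definition open_approx :: "nat \<Rightarrow> 'a::metric_space set \<Rightarrow> 'a \<Rightarrow> real" where
  "open_approx n V x = min 1 (real n * infdist x (- V))"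

lemma open_approx_bounds: "0 \<le> open_approx n V x" "open_approx n V x \<le> 1"
  by (auto simp: open_approx_def infdist_nonneg)

lemma open_approx_continuous: "continuous_on S (open_approx n V)"
  unfolding open_approx_def[abs_def] by (intro continuous_intros)

lemma open_approx_vanish: "x \<notin> V \<Longrightarrow> open_approx n V x = 0"
  by (simp add: open_approx_def)

text \<open>
  The whole space is excluded because the distance to the empty set is \<open>0\<close> by convention, so that
  the approximations of \<open>UNIV\<close> are identically zero.
\<close>

lemma open_approx_tendsto:
  assumes "open V" "V \<noteq> UNIV"
  shows "(\<lambda>n. open_approx n V x) \<longlonglongrightarrow> indicator V x"
proof (cases "x \<in> V")
  case True
  have "infdist x (- V) \<noteq> 0"
    using in_closed_iff_infdist_zero[of "- V" x] assms True by auto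
  then have d: "infdist x (- V) > 0"
    using infdist_nonneg[of x "- V"] by linarith
  obtain n0 :: nat where n0: "1 / infdist x (- V) < real n0"
    using reals_Archimedean2 by blast
  have "eventually (\<lambda>n. open_approx n V x = 1) sequentially"
    using eventually_ge_at_top[of n0]
  proof eventually_elim
    case (elim n)
    then have "1 / infdist x (- V) \<le> real n" using n0 by linarith
    then have "1 \<le> real n * infdist x (- V)" using d by (simp add: field_simps)
    then show ?case by (simp add: open_approx_def)
  qed
  then show ?thesis using True by (simp add: tendsto_eventually)
qed (simp add: open_approx_vanish)

definition open_boxes :: "(int \<Rightarrow> 'a::topological_space) set set" where
  "open_boxes = {Pi\<^sub>E UNIV V | V. (\<forall>i. open (V i)) \<and> finite {i. V i \<noteq> UNIV}}"

lemma Int_stable_open_boxes: "Int_stable open_boxes"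
proof (rule Int_stableI)
  fix a b :: "(int \<Rightarrow> 'a) set" assume "a \<in> open_boxes" "b \<in> open_boxes"
  then obtain V W where V: "a = Pi\<^sub>E UNIV V" "\<And>i. open (V i)" "finite {i. V i \<noteq> UNIV}"
    and W: "b = Pi\<^sub>E UNIV W" "\<And>i. open (W i)" "finite {i. W i \<noteq> UNIV}"
    unfolding open_boxes_def by blast
  have "finite {i. V i \<inter> W i \<noteq> UNIV}"
    by (rule finite_subset[of _ "{i. V i \<noteq> UNIV} \<union> {i. W i \<noteq> UNIV}"]) (use V W in auto)
  moreover have "a \<inter> b = Pi\<^sub>E UNIV (\<lambda>i. V i \<inter> W i)" unfolding V(1) W(1) by auto
  ultimately show "a \<inter> b \<in> open_boxes"
    unfolding open_boxes_def using V(2) W(2)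
    by (intro CollectI exI[of _ "\<lambda>i. V i \<inter> W i"]) auto
qed

lemma borel_eq_open_boxes:
  "sets (borel :: (int \<Rightarrow> 'a::second_countable_topology) measure) = sigma_sets UNIV open_boxes"
proof -
  obtain K :: "(int \<Rightarrow> 'a) set set" where K: "topological_basis K" "countable K"
      "\<forall>k\<in>K. \<exists>X. (k = Pi\<^sub>E UNIV X) \<and> (\<forall>i. open (X i)) \<and> finite {i. X i \<noteq> UNIV}"
    using product_topology_countable_basis by blast
  have "sets (borel :: (int \<Rightarrow> 'a) measure) = sigma_sets UNIV K"
    by (subst borel_eq_countable_basis[OF K(2,1)]) simp
  moreover have "K \<subseteq> open_boxes"
    using K(3) unfolding open_boxes_def by blast
  moreover have "k \<in> sets borel" if "k \<in> open_boxes" for k :: "(int \<Rightarrow> 'a) set"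
    using that unfolding open_boxes_def by (auto intro!: borel_open open_PiE)
  then have "sigma_sets UNIV open_boxes \<subseteq> sets (borel :: (int \<Rightarrow> 'a) measure)"
    using sets.sigma_sets_subset[of open_boxes "borel :: (int \<Rightarrow> 'a) measure"] by auto
  ultimately show ?thesis
    using sigma_sets_mono'[of K open_boxes UNIV] by blast
qed

context tail_process_of_stationary
begin

text \<open>
  Indicators of open boxes are limits of the continuous test functions
  \<open>x \<mapsto> \<Prod>i\<in>F. open_approx n (V i) (x i)\<close>. The box is contained in the set where both
  exceedances happen, so these test functions vanish where they have to.
\<close>

lemma time_change_box:
  fixes V :: "int \<Rightarrow> 'a set"
  assumes t: "t > 0" and V: "\<And>i. open (V i)" "finite {i. V i \<noteq> UNIV}"
    and V0: "V 0 \<subseteq> {x. nrm x > 1}" and Vj: "V (-j) \<subseteq> {x. nrm x > t}"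
  shows "emeasure N {\<omega> \<in> space N. seq_scale t (shift_seq j (Y \<omega>)) \<in> Pi\<^sub>E UNIV V}
       = ennreal (t powr \<alpha>) * emeasure N {\<omega> \<in> space N. Y \<omega> \<in> Pi\<^sub>E UNIV V}"
proof -
  define F where "F = {i. V i \<noteq> UNIV}"
  have F: "finite F" by (simp add: F_def V)
  have "0 \<notin> V 0" "0 \<notin> V (-j)" using subsetD[OF V0, of 0] subsetD[OF Vj, of 0] t by auto
  then have inF: "0 \<in> F" "-j \<in> F" unfolding F_def by blast+
  define f where "f = (\<lambda>n x. \<Prod>i\<in>F. open_approx n (V i) (x i))"
  have f_bounds: "0 \<le> f n x" "f n x \<le> 1" for n x
    unfolding f_def by (auto intro!: prod_nonneg prod_le_1 simp: open_approx_bounds)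
  have f_cont: "continuous_on UNIV (f n)" for n
    unfolding f_def
    by (intro continuous_on_prod continuous_on_compose2[OF open_approx_continuous[of UNIV]]
          continuous_on_product_coordinates) auto
  have [measurable]: "f n \<in> borel_measurable borel" for n
    by (rule borel_measurable_continuous_onI[OF f_cont])
  define m where "m = Max (abs ` F)"
  have m: "\<bar>i\<bar> \<le> m" if "i \<in> F" for i
    unfolding m_def using F that by (intro Max_ge) auto
  have f_local: "f n (restrict x {-m..m}) = f n x" for n x
    unfolding f_def
  proof (rule prod.cong)
    fix i assume "i \<in> F"
    then have "-m \<le> i" "i \<le> m" using m[of i] by auto
    then show "open_approx n (V i) (restrict x {-m..m} i) = open_approx n (V i) (x i)" by simp
  qed simp
  have f_vanish: "f n x = 0" if "nrm (x 0) \<le> 1 \<or> nrm (x (-j)) \<le> t" for n x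
  proof -
    have "x 0 \<notin> V 0 \<or> x (-j) \<notin> V (-j)" using that V0 Vj by (auto dest: subsetD)
    then show ?thesis
      unfolding f_def prod_zero_iff[OF F] using inF open_approx_vanish by blast
  qed
  have f_bdd: "bounded (range (f n))" for n
    by (rule boundedI[of _ 1]) (use f_bounds in auto)
  have f_lim: "(\<lambda>n. f n x) \<longlonglongrightarrow> indicator (Pi\<^sub>E UNIV V) x" for x
  proof -
    have "(\<lambda>n. f n x) \<longlonglongrightarrow> (\<Prod>i\<in>F. indicator (V i) (x i))"
      unfolding f_def by (intro tendsto_prod open_approx_tendsto) (auto simp: F_def V)
    also have "(\<Prod>i\<in>F. indicator (V i) (x i)) = (indicator (Pi\<^sub>E UNIV V) x :: real)"
    proof (cases "x \<in> Pi\<^sub>E UNIV V")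
      case False
      then obtain i where "x i \<notin> V i" by auto
      then have "i \<in> F" "indicator (V i) (x i) = (0::real)" by (auto simp: F_def)
      then have "(\<Prod>i\<in>F. indicator (V i) (x i)) = (0::real)" using F by (meson prod_zero)
      then show ?thesis using False by simp
    next
      case True
      then have "(\<Prod>i\<in>F. indicator (V i) (x i)) = (\<Prod>i\<in>F. 1::real)" by (intro prod.cong) (auto simp: PiE_iff)
      with True show ?thesis by simp
    qed
    finally show ?thesis .
  qed
  have lim: "(\<lambda>n. LINT \<omega>|N. f n (Z \<omega>)) \<longlonglongrightarrow> measure N {\<omega> \<in> space N. Z \<omega> \<in> Pi\<^sub>E UNIV V}"
    if [measurable]: "Z \<in> borel_measurable N" for Z
  proof -
    have [measurable]: "Pi\<^sub>E UNIV V \<in> sets borel"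
      using borel_open[OF open_PiE[of V]] V by auto
    have "(\<lambda>n. LINT \<omega>|N. f n (Z \<omega>)) \<longlonglongrightarrow> (LINT \<omega>|N. indicator (Pi\<^sub>E UNIV V) (Z \<omega>))"
      by (rule integral_dominated_convergence[where w = "\<lambda>_. 1"])
         (auto simp: f_lim f_bounds)
    also have "(LINT \<omega>|N. indicator (Pi\<^sub>E UNIV V) (Z \<omega>)) = (LINT \<omega>|N. indicator {\<omega> \<in> space N. Z \<omega> \<in> Pi\<^sub>E UNIV V} \<omega>)"
      by (rule Bochner_Integration.integral_cong) (auto simp: indicator_def)
    also have "\<dots> = measure N {\<omega> \<in> space N. Z \<omega> \<in> Pi\<^sub>E UNIV V}" by simp
    finally show ?thesis .
  qed
  have "(\<lambda>n. t powr \<alpha> * (LINT \<omega>|N. f n (Y \<omega>)))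
     \<longlonglongrightarrow> measure N {\<omega> \<in> space N. seq_scale t (shift_seq j (Y \<omega>)) \<in> Pi\<^sub>E UNIV V}"
  proof -
    have "(\<lambda>\<omega>. seq_scale t (shift_seq j (Y \<omega>))) \<in> borel_measurable N" by measurable
    note lim[OF this]
    moreover have "(LINT \<omega>|N. f n (seq_scale t (shift_seq j (Y \<omega>)))) = t powr \<alpha> * (LINT \<omega>|N. f n (Y \<omega>))" for n
      by (rule time_change_continuous[OF t f_cont f_bdd f_local]) (use m[OF inF(2)] f_vanish in auto)
    ultimately show ?thesis by simp
  qed
  moreover have "(\<lambda>n. t powr \<alpha> * (LINT \<omega>|N. f n (Y \<omega>)))
     \<longlonglongrightarrow> t powr \<alpha> * measure N {\<omega> \<in> space N. Y \<omega> \<in> Pi\<^sub>E UNIV V}"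
    by (intro tendsto_mult tendsto_const lim Y)
  ultimately have "measure N {\<omega> \<in> space N. seq_scale t (shift_seq j (Y \<omega>)) \<in> Pi\<^sub>E UNIV V}
      = t powr \<alpha> * measure N {\<omega> \<in> space N. Y \<omega> \<in> Pi\<^sub>E UNIV V}"
    by (rule LIMSEQ_unique)
  then show ?thesis by (simp add: N.emeasure_eq_measure ennreal_mult')
qed

lemma nrm_Y0_gt_1: "AE \<omega> in N. nrm (Y \<omega> 0) > 1"
proof -
  have "measure N (exceedance nrm N Y 1) = 1"
    using tail unfolding tail_process_def by force
  then have "AE \<omega> in N. \<omega> \<in> exceedance nrm N Y 1"
    by (rule N.AE_prob_1)
  then show ?thesis by eventually_elim (simp add: exceedance_def)
qed

text \<open>
  The time change formula. Both sides are integrals of \<open>f\<close> against finite measures that live on the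
  open set \<open>U\<close> where coordinates \<open>0\<close> and \<open>-j\<close> exceed \<open>1\<close> and \<open>t\<close>, and that agree on open boxes.
  On each side one of the two exceedances is automatic since \<open>|Y\<^sub>0| > 1\<close>.
\<close>

theorem time_change:
  fixes f :: "(int \<Rightarrow> 'a) \<Rightarrow> ennreal"
  assumes t: "t > 0" and f [measurable]: "f \<in> borel_measurable borel"
  shows "(\<integral>\<^sup>+\<omega>. f (seq_scale t (shift_seq j (Y \<omega>))) * indicator {\<omega>. t * nrm (Y \<omega> j) > 1} \<omega> \<partial>N)
     = ennreal (t powr \<alpha>) * (\<integral>\<^sup>+\<omega>. f (Y \<omega>) * indicator {\<omega>. nrm (Y \<omega> (-j)) > t} \<omega> \<partial>N)"
proof -
  define U where "U = {x :: int \<Rightarrow> 'a. nrm (x 0) > 1 \<and> nrm (x (-j)) > t}"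
  define W where "W = (\<lambda>i::int. (if i = 0 then {x. nrm x > 1} else UNIV) \<inter> (if i = -j then {x. nrm x > t} else UNIV))"
  have open_nrm: "open {x. nrm x > c}" for c
    by (rule open_Collect_less) (auto intro: nrm_continuous)
  have W: "open (W i)" for i
    unfolding W_def by (auto intro!: open_Int open_nrm)
  have finW: "finite {i. W i \<noteq> UNIV}"
    by (rule finite_subset[of _ "{0, -j}"]) (auto simp: W_def)
  have U: "U = Pi\<^sub>E UNIV W"
    unfolding U_def W_def by (auto simp: PiE_iff split: if_splits)
  have [measurable]: "U \<in> sets borel"
    unfolding U using borel_open[OF open_PiE[of W]] W finW by auto
  define Z where "Z = (\<lambda>\<omega>. seq_scale t (shift_seq j (Y \<omega>)))"
  have [measurable]: "Z \<in> borel_measurable N" unfolding Z_def by measurable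
  let ?\<mu> = "density (distr N borel Z) (indicator U)"
  let ?\<nu> = "density (scale_measure (ennreal (t powr \<alpha>)) (distr N borel Y)) (indicator U)"
  have "?\<mu> = ?\<nu>"
  proof (rule measure_eqI_generator_eq_countable[OF Int_stable_open_boxes, of UNIV])
    fix k :: "(int \<Rightarrow> 'a) set" assume "k \<in> open_boxes"
    then obtain V where V: "k = Pi\<^sub>E UNIV V" "\<And>i. open (V i)" "finite {i. V i \<noteq> UNIV}"
      unfolding open_boxes_def by blast
    have k [measurable]: "k \<in> sets borel"
      unfolding V(1) using borel_open[OF open_PiE[of V]] V by auto
    have kU: "U \<inter> k = Pi\<^sub>E UNIV (\<lambda>i. V i \<inter> W i)"
      unfolding U V(1) by auto
    have fin: "finite {i. V i \<inter> W i \<noteq> UNIV}"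
      by (rule finite_subset[of _ "{i. V i \<noteq> UNIV} \<union> {i. W i \<noteq> UNIV}"]) (use V finW in auto)
    have "emeasure ?\<mu> k = emeasure N {\<omega> \<in> space N. Z \<omega> \<in> U \<inter> k}"
      by (subst emeasure_restricted) (auto simp: emeasure_distr intro!: arg_cong[where f = "emeasure N"])
    also have "\<dots> = ennreal (t powr \<alpha>) * emeasure N {\<omega> \<in> space N. Y \<omega> \<in> U \<inter> k}"
      unfolding kU Z_def
      by (rule time_change_box[OF t _ fin]) (auto intro!: open_Int V(2) W, auto simp: W_def)
    also have "\<dots> = emeasure ?\<nu> k"
      by (subst emeasure_restricted)
         (auto simp: emeasure_distr emeasure_scale_measure intro!: arg_cong[where f = "\<lambda>A. _ * emeasure N A"])
    finally show "emeasure ?\<mu> k = emeasure ?\<nu> k" .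
  next
    show "{UNIV :: (int \<Rightarrow> 'a) set} \<subseteq> open_boxes"
      unfolding open_boxes_def by (auto intro!: exI[of _ "\<lambda>_. UNIV"])
    show "emeasure ?\<mu> a \<noteq> \<infinity>" if "a \<in> {UNIV}" for a
    proof -
      have "emeasure ?\<mu> UNIV = emeasure (distr N borel Z) (U \<inter> UNIV)"
        by (rule emeasure_restricted) auto
      then show ?thesis using that by (simp add: emeasure_distr)
    qed
  qed (auto simp: borel_eq_open_boxes)
  then have "(\<integral>\<^sup>+x. f x \<partial>?\<mu>) = (\<integral>\<^sup>+x. f x \<partial>?\<nu>)" by simp
  also have "(\<integral>\<^sup>+x. f x \<partial>?\<mu>) = (\<integral>\<^sup>+\<omega>. indicator U (Z \<omega>) * f (Z \<omega>) \<partial>N)"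
    by (simp add: nn_integral_density nn_integral_distr)
  also have "\<dots> = (\<integral>\<^sup>+\<omega>. f (seq_scale t (shift_seq j (Y \<omega>))) * indicator {\<omega>. t * nrm (Y \<omega> j) > 1} \<omega> \<partial>N)"
    by (rule nn_integral_cong_AE, rule AE_mp[OF nrm_Y0_gt_1], rule AE_I2)
       (use t in \<open>auto simp: U_def Z_def seq_scale_def shift_seq_def indicator_def\<close>)
  also have "(\<integral>\<^sup>+x. f x \<partial>?\<nu>) = ennreal (t powr \<alpha>) * (\<integral>\<^sup>+\<omega>. indicator U (Y \<omega>) * f (Y \<omega>) \<partial>N)"
    by (simp add: nn_integral_density nn_integral_distr nn_integral_scale_measure)
  also have "(\<integral>\<^sup>+\<omega>. indicator U (Y \<omega>) * f (Y \<omega>) \<partial>N)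
      = (\<integral>\<^sup>+\<omega>. f (Y \<omega>) * indicator {\<omega>. nrm (Y \<omega> (-j)) > t} \<omega> \<partial>N)"
    by (rule nn_integral_cong_AE, rule AE_mp[OF nrm_Y0_gt_1], rule AE_I2)
       (auto simp: U_def indicator_def)
  finally show ?thesis .
qed

end

section \<open>Polar decomposition of the tail process\<close>

context tail_process_of_stationary
begin

lemma spectral_measurable [measurable]: "spectral nrm \<in> borel_measurable borel"
proof -
  have "(\<lambda>x :: int \<Rightarrow> 'a. x 0) \<in> borel_measurable borel"
    by (rule measurable_product_coordinates)
  then have "(\<lambda>x. 1 / nrm (x 0)) \<in> borel_measurable borel" by measurable
  then show ?thesis
    unfolding spectral_def[abs_def] by (intro measurable_seq_scale) simp_all
qed

abbreviation \<Theta> :: "'v \<Rightarrow> int \<Rightarrow> 'a" where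
  "\<Theta> \<omega> \<equiv> spectral nrm (Y \<omega>)"

lemma Y_eq_scale_\<Theta>: "Y \<omega> = seq_scale (nrm (Y \<omega> 0)) (\<Theta> \<omega>)" if "nrm (Y \<omega> 0) > 1"
  using that by (cases "Y \<omega> 0 = 0") (simp_all add: spectral_def seq_scale_def)

text \<open>
  Valid for all sequences: if \<open>x 0 = 0\<close>, both sides are the zero sequence, as \<open>1 / 0 = 0\<close>.
\<close>

lemma spectral_scale: "c > 0 \<Longrightarrow> spectral nrm (seq_scale c x) = spectral nrm x"
  by (auto simp: spectral_def seq_scale_def)

lemma nrm_\<Theta>_0: "nrm (\<Theta> \<omega> 0) = 1" if "nrm (Y \<omega> 0) > 1"
  using that by (cases "Y \<omega> 0 = 0") (simp_all add: spectral_def seq_scale_def)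

text \<open>
  The time change formula with \<open>j = 0\<close> and \<open>t = 1 / a\<close>: the spectral process does not change under
  scaling, and \<open>|Y\<^sub>0| > 1 / a\<close> is certain because \<open>1 / a \<le> 1\<close>.
\<close>

lemma spectral_independent_tail:
  fixes \<psi> :: "(int \<Rightarrow> 'a) \<Rightarrow> ennreal"
  assumes [measurable]: "\<psi> \<in> borel_measurable borel" and a: "a \<ge> 1"
  shows "(\<integral>\<^sup>+\<omega>. \<psi> (\<Theta> \<omega>) * indicator {a<..} (nrm (Y \<omega> 0)) \<partial>N)
       = ennreal (a powr -\<alpha>) * (\<integral>\<^sup>+\<omega>. \<psi> (\<Theta> \<omega>) \<partial>N)"
proof -
  have t: "1 / a > 0" using a by simp
  have "(\<integral>\<^sup>+\<omega>. \<psi> (\<Theta> \<omega>) * indicator {a<..} (nrm (Y \<omega> 0)) \<partial>N)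
     = (\<integral>\<^sup>+\<omega>. \<psi> (spectral nrm (seq_scale (1 / a) (shift_seq 0 (Y \<omega>)))) * indicator {\<omega>. 1 / a * nrm (Y \<omega> 0) > 1} \<omega> \<partial>N)"
    unfolding spectral_scale[OF t] using a
    by (intro nn_integral_cong) (auto simp: shift_seq_def indicator_def)
  also have "\<dots> = ennreal ((1 / a) powr \<alpha>) * (\<integral>\<^sup>+\<omega>. \<psi> (\<Theta> \<omega>) * indicator {\<omega>. nrm (Y \<omega> (-0)) > 1 / a} \<omega> \<partial>N)"
    by (rule time_change[OF t]) measurable
  also have "(\<integral>\<^sup>+\<omega>. \<psi> (\<Theta> \<omega>) * indicator {\<omega>. nrm (Y \<omega> (-0)) > 1 / a} \<omega> \<partial>N) = (\<integral>\<^sup>+\<omega>. \<psi> (\<Theta> \<omega>) \<partial>N)"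
  proof (rule nn_integral_cong_AE, rule AE_mp[OF nrm_Y0_gt_1], rule AE_I2, rule impI)
    fix \<omega> assume "nrm (Y \<omega> 0) > 1"
    moreover have "1 / a \<le> 1" using a by simp
    ultimately show "\<psi> (\<Theta> \<omega>) * indicator {\<omega>. nrm (Y \<omega> (-0)) > 1 / a} \<omega> = \<psi> (\<Theta> \<omega>)" by simp
  qed
  also have "(1 / a) powr \<alpha> = a powr -\<alpha>" using a by (simp add: powr_divide powr_minus_divide)
  finally show ?thesis .
qed

lemma emeasure_nrm_Y0:
  "emeasure (distr N borel (\<lambda>\<omega>. nrm (Y \<omega> 0))) {a<..} = ennreal (max 1 a powr -\<alpha>)"
proof -
  have "emeasure (distr N borel (\<lambda>\<omega>. nrm (Y \<omega> 0))) {a<..}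
      = (\<integral>\<^sup>+\<omega>. indicator {a<..} (nrm (Y \<omega> 0)) \<partial>N)"
    by (simp add: nn_integral_distr flip: nn_integral_indicator)
  also have "\<dots> = (\<integral>\<^sup>+\<omega>. 1 * indicator {max 1 a<..} (nrm (Y \<omega> 0)) \<partial>N)"
    by (rule nn_integral_cong_AE, rule AE_mp[OF nrm_Y0_gt_1], rule AE_I2) (auto simp: indicator_def)
  also have "\<dots> = ennreal (max 1 a powr -\<alpha>)"
    by (subst spectral_independent_tail) (auto simp: N.emeasure_space_1)
  finally show ?thesis .
qed

text \<open>
  Independence of the spectral process and \<open>|Y\<^sub>0|\<close>. Half lines suffice to identify the law of
  \<open>|Y\<^sub>0|\<close> on each event \<open>\<Theta> \<in> A\<close>.
\<close>

lemma spectral_pair_distr: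
  "distr N borel (\<lambda>\<omega>. \<Theta> \<omega>) \<Otimes>\<^sub>M distr N borel (\<lambda>\<omega>. nrm (Y \<omega> 0))
     = distr N (borel \<Otimes>\<^sub>M borel) (\<lambda>\<omega>. (\<Theta> \<omega>, nrm (Y \<omega> 0)))"
proof (rule pair_measure_eqI)
  interpret P: prob_space "distr N borel (\<lambda>\<omega>. \<Theta> \<omega>)" by (rule N.prob_space_distr) measurable
  interpret R: prob_space "distr N borel (\<lambda>\<omega>. nrm (Y \<omega> 0))" by (rule N.prob_space_distr) measurable
  show "sigma_finite_measure (distr N borel (\<lambda>\<omega>. \<Theta> \<omega>))"
    "sigma_finite_measure (distr N borel (\<lambda>\<omega>. nrm (Y \<omega> 0)))"
    by unfold_locales
  show "sets (distr N borel (\<lambda>\<omega>. \<Theta> \<omega>) \<Otimes>\<^sub>M distr N borel (\<lambda>\<omega>. nrm (Y \<omega> 0)))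
     = sets (distr N (borel \<Otimes>\<^sub>M borel) (\<lambda>\<omega>. (\<Theta> \<omega>, nrm (Y \<omega> 0))))"
    by (simp cong: sets_pair_measure_cong)
next
  fix A :: "(int \<Rightarrow> 'a) set" and B :: "real set"
  assume A0: "A \<in> sets (distr N borel (\<lambda>\<omega>. \<Theta> \<omega>))" and B0: "B \<in> sets (distr N borel (\<lambda>\<omega>. nrm (Y \<omega> 0)))"
  from A0 have A [measurable]: "A \<in> sets borel" by simp
  from B0 have B [measurable]: "B \<in> sets borel" by simp
  let ?\<rho> = "distr N borel (\<lambda>\<omega>. nrm (Y \<omega> 0))"
  let ?p = "\<integral>\<^sup>+\<omega>. indicator A (\<Theta> \<omega>) \<partial>N"
  have "?p \<le> (\<integral>\<^sup>+\<omega>. 1 \<partial>N)" by (intro nn_integral_mono) (auto simp: indicator_def)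
  then have p: "?p < \<infinity>" by (simp add: N.emeasure_space_1 order_le_less_trans)
  have *: "emeasure (distr (density N (\<lambda>\<omega>. indicator A (\<Theta> \<omega>))) borel (\<lambda>\<omega>. nrm (Y \<omega> 0))) B
     = (\<integral>\<^sup>+\<omega>. indicator A (\<Theta> \<omega>) * indicator B (nrm (Y \<omega> 0)) \<partial>N)" if [measurable]: "B \<in> sets borel" for B
    by (simp add: nn_integral_distr nn_integral_density flip: nn_integral_indicator)
  have "distr (density N (\<lambda>\<omega>. indicator A (\<Theta> \<omega>))) borel (\<lambda>\<omega>. nrm (Y \<omega> 0)) = scale_measure ?p ?\<rho>"
  proof (rule measure_eqI_lessThan)
    have eq: "emeasure (distr (density N (\<lambda>\<omega>. indicator A (\<Theta> \<omega>))) borel (\<lambda>\<omega>. nrm (Y \<omega> 0))) {x<..}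
        = ennreal (max 1 x powr -\<alpha>) * ?p" for x
    proof -
      have "(\<integral>\<^sup>+\<omega>. indicator A (\<Theta> \<omega>) * indicator {x<..} (nrm (Y \<omega> 0)) \<partial>N)
        = (\<integral>\<^sup>+\<omega>. indicator A (\<Theta> \<omega>) * indicator {max 1 x<..} (nrm (Y \<omega> 0)) \<partial>N)"
        by (rule nn_integral_cong_AE, rule AE_mp[OF nrm_Y0_gt_1], rule AE_I2) (auto simp: indicator_def)
      then show ?thesis by (subst *) (simp_all add: spectral_independent_tail)
    qed
    show "emeasure (distr (density N (\<lambda>\<omega>. indicator A (\<Theta> \<omega>))) borel (\<lambda>\<omega>. nrm (Y \<omega> 0))) {x<..} < \<infinity>" for x
      unfolding eq using p by (simp add: ennreal_mult_less_top)
    show "emeasure (distr (density N (\<lambda>\<omega>. indicator A (\<Theta> \<omega>))) borel (\<lambda>\<omega>. nrm (Y \<omega> 0))) {x<..}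
      = emeasure (scale_measure ?p ?\<rho>) {x<..}" for x
      unfolding eq emeasure_scale_measure emeasure_nrm_Y0 by (rule mult.commute)
  qed simp_all
  then have "(\<integral>\<^sup>+\<omega>. indicator A (\<Theta> \<omega>) * indicator B (nrm (Y \<omega> 0)) \<partial>N) = ?p * emeasure ?\<rho> B"
    using *[OF B] by simp
  moreover have "?p = emeasure (distr N borel (\<lambda>\<omega>. \<Theta> \<omega>)) A"
    by (simp add: nn_integral_distr flip: nn_integral_indicator)
  moreover have "(\<integral>\<^sup>+\<omega>. indicator A (\<Theta> \<omega>) * indicator B (nrm (Y \<omega> 0)) \<partial>N)
    = emeasure (distr N (borel \<Otimes>\<^sub>M borel) (\<lambda>\<omega>. (\<Theta> \<omega>, nrm (Y \<omega> 0)))) (A \<times> B)"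
    by (simp add: nn_integral_distr indicator_times flip: nn_integral_indicator)
  ultimately show "emeasure (distr N borel (\<lambda>\<omega>. \<Theta> \<omega>)) A * emeasure ?\<rho> B
    = emeasure (distr N (borel \<Otimes>\<^sub>M borel) (\<lambda>\<omega>. (\<Theta> \<omega>, nrm (Y \<omega> 0)))) (A \<times> B)" by simp
qed

lemma polar:
  assumes [measurable]: "F \<in> borel_measurable (borel \<Otimes>\<^sub>M borel)"
  shows "(\<integral>\<^sup>+\<omega>. F (\<Theta> \<omega>, nrm (Y \<omega> 0)) \<partial>N)
       = (\<integral>\<^sup>+\<omega>. (\<integral>\<^sup>+r. F (\<Theta> \<omega>, r) \<partial>distr N borel (\<lambda>\<omega>. nrm (Y \<omega> 0))) \<partial>N)"
proof -
  let ?P = "distr N borel (\<lambda>\<omega>. \<Theta> \<omega>)" and ?\<rho> = "distr N borel (\<lambda>\<omega>. nrm (Y \<omega> 0))"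
  interpret R: prob_space ?\<rho> by (rule N.prob_space_distr) measurable
  have F: "F \<in> borel_measurable (borel \<Otimes>\<^sub>M ?\<rho>)" "F \<in> borel_measurable (?P \<Otimes>\<^sub>M ?\<rho>)"
    by (simp_all cong: measurable_cong_sets sets_pair_measure_cong)
  have "(\<integral>\<^sup>+\<omega>. F (\<Theta> \<omega>, nrm (Y \<omega> 0)) \<partial>N)
      = (\<integral>\<^sup>+z. F z \<partial>distr N (borel \<Otimes>\<^sub>M borel) (\<lambda>\<omega>. (\<Theta> \<omega>, nrm (Y \<omega> 0))))"
    by (simp add: nn_integral_distr)
  also have "\<dots> = (\<integral>\<^sup>+x. (\<integral>\<^sup>+r. F (x, r) \<partial>?\<rho>) \<partial>?P)"
    unfolding spectral_pair_distr[symmetric]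
    by (rule R.nn_integral_fst[symmetric]) (rule F)
  also have "\<dots> = (\<integral>\<^sup>+\<omega>. (\<integral>\<^sup>+r. F (\<Theta> \<omega>, r) \<partial>?\<rho>) \<partial>N)"
    by (rule nn_integral_distr) (use R.borel_measurable_nn_integral_fst[OF F(1)] in simp_all)
  finally show ?thesis .
qed

lemma emeasure_nrm_Y0_mult:
  assumes "c \<ge> 0"
  shows "emeasure (distr N borel (\<lambda>\<omega>. nrm (Y \<omega> 0))) {r. r * c > 1} = ennreal (min 1 (c powr \<alpha>))"
proof (cases "c = 0")
  case False
  with assms have c: "c > 0" by simp
  then have "{r. r * c > 1} = {1 / c<..}" by (auto simp: field_simps)
  moreover have "max 1 (1 / c) powr -\<alpha> = min 1 (c powr \<alpha>)"
  proof (cases "c \<le> 1")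
    case True
    then have "max 1 (1 / c) = 1 / c" using c by simp
    moreover have "c powr \<alpha> \<le> 1" using True c \<alpha> by (simp add: powr_le1)
    ultimately show ?thesis using c by (simp add: powr_divide powr_minus_divide)
  next
    case False
    then have "max 1 (1 / c) = 1" using c by simp
    moreover have "c powr \<alpha> \<ge> 1" using False \<alpha> by (simp add: ge_one_powr_ge_zero)
    ultimately show ?thesis by simp
  qed
  ultimately show ?thesis by (simp add: emeasure_nrm_Y0)
qed simp

text \<open>
  Integrating out the radius \<open>|Y\<^sub>0|\<close>, which has a Pareto law, turns a threshold on
  \<open>|Y\<^sub>0| m(\<Theta>)\<close> into a power of \<open>m(\<Theta>)\<close>. This and the next lemma are the passage between
  statements on \<open>Y\<close> and statements on homogeneous functionals of \<open>\<Theta>\<close>.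
\<close>

lemma polar_gt:
  fixes \<psi> :: "(int \<Rightarrow> 'a) \<Rightarrow> ennreal" and m :: "(int \<Rightarrow> 'a) \<Rightarrow> real"
  assumes [measurable]: "\<psi> \<in> borel_measurable borel" "m \<in> borel_measurable borel"
    and m: "\<And>x. m x \<ge> 0"
  shows "(\<integral>\<^sup>+\<omega>. \<psi> (\<Theta> \<omega>) * indicator {\<omega>. nrm (Y \<omega> 0) * m (\<Theta> \<omega>) > 1} \<omega> \<partial>N)
       = (\<integral>\<^sup>+\<omega>. \<psi> (\<Theta> \<omega>) * ennreal (min 1 (m (\<Theta> \<omega>) powr \<alpha>)) \<partial>N)"
proof -
  let ?\<rho> = "distr N borel (\<lambda>\<omega>. nrm (Y \<omega> 0))"
  define F where "F = (\<lambda>(x, r). \<psi> x * indicator {z. snd z * m (fst z) > 1} (x, r))"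
  have F: "F \<in> borel_measurable (borel \<Otimes>\<^sub>M borel)" unfolding F_def by measurable
  have "(\<integral>\<^sup>+r. F (x, r) \<partial>?\<rho>) = \<psi> x * ennreal (min 1 (m x powr \<alpha>))" for x
  proof -
    have "(\<integral>\<^sup>+r. F (x, r) \<partial>?\<rho>) = (\<integral>\<^sup>+r. \<psi> x * indicator {r. r * m x > 1} r \<partial>?\<rho>)"
      by (rule nn_integral_cong) (simp add: F_def indicator_def)
    also have "\<dots> = \<psi> x * emeasure ?\<rho> {r. r * m x > 1}"
      by (rule nn_integral_cmult_indicator) measurable
    finally show ?thesis by (simp only: emeasure_nrm_Y0_mult[OF m])
  qed
  with polar[OF F] show ?thesis by (simp add: F_def indicator_def)
qed

lemma polar_le:
  fixes \<psi> :: "(int \<Rightarrow> 'a) \<Rightarrow> ennreal" and m :: "(int \<Rightarrow> 'a) \<Rightarrow> real"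
  assumes [measurable]: "\<psi> \<in> borel_measurable borel" "m \<in> borel_measurable borel"
    and m: "\<And>x. m x \<ge> 0"
  shows "(\<integral>\<^sup>+\<omega>. \<psi> (\<Theta> \<omega>) * indicator {\<omega>. nrm (Y \<omega> 0) * m (\<Theta> \<omega>) \<le> 1} \<omega> \<partial>N)
       = (\<integral>\<^sup>+\<omega>. \<psi> (\<Theta> \<omega>) * ennreal (1 - min 1 (m (\<Theta> \<omega>) powr \<alpha>)) \<partial>N)"
proof -
  let ?\<rho> = "distr N borel (\<lambda>\<omega>. nrm (Y \<omega> 0))"
  interpret R: prob_space ?\<rho> by (rule N.prob_space_distr) measurable
  define F where "F = (\<lambda>(x, r). \<psi> x * indicator {z. snd z * m (fst z) \<le> 1} (x, r))"
  have F: "F \<in> borel_measurable (borel \<Otimes>\<^sub>M borel)" unfolding F_def by measurable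
  have "(\<integral>\<^sup>+r. F (x, r) \<partial>?\<rho>) = \<psi> x * ennreal (1 - min 1 (m x powr \<alpha>))" for x
  proof -
    have "(\<integral>\<^sup>+r. F (x, r) \<partial>?\<rho>) = (\<integral>\<^sup>+r. \<psi> x * indicator (space ?\<rho> - {r. r * m x > 1}) r \<partial>?\<rho>)"
      by (rule nn_integral_cong) (auto simp: F_def indicator_def)
    also have "\<dots> = \<psi> x * emeasure ?\<rho> (space ?\<rho> - {r. r * m x > 1})"
      by (rule nn_integral_cmult_indicator) measurable
    also have "emeasure ?\<rho> (space ?\<rho> - {r. r * m x > 1}) = ennreal (1 - measure ?\<rho> {r. r * m x > 1})"
      unfolding R.emeasure_eq_measure by (subst R.prob_compl) auto
    also have "measure ?\<rho> {r. r * m x > 1} = min 1 (m x powr \<alpha>)"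
      using emeasure_nrm_Y0_mult[OF m, of x] by (simp add: measure_def)
    finally show ?thesis .
  qed
  with polar[OF F] show ?thesis by (simp add: F_def indicator_def)
qed

end

section \<open>Time change for homogeneous functionals of the spectral process\<close>

context tail_process_of_stationary
begin

text \<open>
  Time change for \<open>\<alpha>\<close>-homogeneous functionals. Apply the time change formula of \<open>Y\<close> at level
  \<open>t = 1 / (n + 1)\<close> to the scale invariant functional \<open>\<phi> x = g x / |x\<^sub>0|\<^sup>\<alpha>\<close> and integrate out
  \<open>|Y\<^sub>0|\<close> on both sides. After division by \<open>t\<^sup>\<alpha>\<close> there remain the integrands \<open>g\<close> with weights
  \<open>w n |\<Theta>\<^sub>j|\<close> on the left and \<open>v n |\<Theta>\<^sub>-\<^sub>j|\<close> on the right, both of which increase to the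
  indicator of a nonzero coordinate as \<open>n\<close> grows.
\<close>

lemma spectral_time_change:
  fixes g :: "(int \<Rightarrow> 'a) \<Rightarrow> ennreal"
  assumes g [measurable]: "g \<in> borel_measurable borel"
    and hom: "\<And>c x. c > 0 \<Longrightarrow> g (seq_scale c x) = ennreal (c powr \<alpha>) * g x"
  shows "(\<integral>\<^sup>+\<omega>. g (shift_seq j (\<Theta> \<omega>)) * indicator {\<omega>. \<Theta> \<omega> j \<noteq> 0} \<omega> \<partial>N)
       = (\<integral>\<^sup>+\<omega>. g (\<Theta> \<omega>) * indicator {\<omega>. \<Theta> \<omega> (-j) \<noteq> 0} \<omega> \<partial>N)"
proof -
  have coord [measurable]: "(\<lambda>x :: int \<Rightarrow> 'a. x i) \<in> borel_measurable borel" for i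
    by (rule measurable_product_coordinates)
  define \<phi> where "\<phi> = (\<lambda>x :: int \<Rightarrow> 'a. g x * ennreal (nrm (x 0) powr -\<alpha>))"
  have \<phi> [measurable]: "\<phi> \<in> borel_measurable borel" unfolding \<phi>_def by measurable
  have \<phi>_scale: "\<phi> (seq_scale c x) = \<phi> x" if "c > 0" for c x
  proof -
    have "(c * nrm (x 0)) powr -\<alpha> = c powr -\<alpha> * nrm (x 0) powr -\<alpha>"
      using that by (simp add: powr_mult)
    then have "\<phi> (seq_scale c x) = g x * (ennreal (c powr \<alpha>) * ennreal (c powr -\<alpha>)) * ennreal (nrm (x 0) powr -\<alpha>)"
      unfolding \<phi>_def hom[OF that] using that by (simp add: seq_scale_def ennreal_mult' mult_ac)
    also have "ennreal (c powr \<alpha>) * ennreal (c powr -\<alpha>) = 1"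
      using that by (simp add: powr_minus flip: ennreal_mult')
    finally show ?thesis by (simp add: \<phi>_def)
  qed
  define w where "w = (\<lambda>(n::nat) r. real (Suc n) powr \<alpha> * (r powr -\<alpha> * min 1 ((r / real (Suc n)) powr \<alpha>)))"
  define v where "v = (\<lambda>(n::nat) r. min 1 ((real (Suc n) * r) powr \<alpha>))"
  have step: "(\<integral>\<^sup>+\<omega>. g (shift_seq j (\<Theta> \<omega>)) * ennreal (w n (nrm (\<Theta> \<omega> j))) \<partial>N)
      = (\<integral>\<^sup>+\<omega>. g (\<Theta> \<omega>) * ennreal (v n (nrm (\<Theta> \<omega> (-j)))) \<partial>N)" (is "?L = ?R") for n
  proof -
    define t where "t = 1 / real (Suc n)"
    have t: "t > 0" by (simp add: t_def)
    have "(\<integral>\<^sup>+\<omega>. \<phi> (seq_scale t (shift_seq j (Y \<omega>))) * indicator {\<omega>. t * nrm (Y \<omega> j) > 1} \<omega> \<partial>N)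
        = (\<integral>\<^sup>+\<omega>. \<phi> (shift_seq j (\<Theta> \<omega>)) * indicator {\<omega>. nrm (Y \<omega> 0) * (t * nrm (\<Theta> \<omega> j)) > 1} \<omega> \<partial>N)"
    proof (rule nn_integral_cong_AE, rule AE_mp[OF nrm_Y0_gt_1], rule AE_I2, rule impI)
      fix \<omega> assume Y0: "nrm (Y \<omega> 0) > 1"
      have "shift_seq j (Y \<omega>) = seq_scale (nrm (Y \<omega> 0)) (shift_seq j (\<Theta> \<omega>))"
        by (subst Y_eq_scale_\<Theta>[OF Y0]) (simp add: shift_seq_def seq_scale_def)
      moreover have "nrm (Y \<omega> j) = nrm (Y \<omega> 0) * nrm (\<Theta> \<omega> j)"
        by (subst Y_eq_scale_\<Theta>[OF Y0]) (simp add: seq_scale_def)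
      ultimately show "\<phi> (seq_scale t (shift_seq j (Y \<omega>))) * indicator {\<omega>. t * nrm (Y \<omega> j) > 1} \<omega>
        = \<phi> (shift_seq j (\<Theta> \<omega>)) * indicator {\<omega>. nrm (Y \<omega> 0) * (t * nrm (\<Theta> \<omega> j)) > 1} \<omega>"
        using Y0 t by (simp add: \<phi>_scale indicator_def mult_ac)
    qed
    also have "\<dots> = (\<integral>\<^sup>+\<omega>. \<phi> (shift_seq j (\<Theta> \<omega>)) * ennreal (min 1 ((t * nrm (\<Theta> \<omega> j)) powr \<alpha>)) \<partial>N)"
      using t by (intro polar_gt[of "\<lambda>x. \<phi> (shift_seq j x)" "\<lambda>x. t * nrm (x j)"]) auto
    also have "\<dots> = (\<integral>\<^sup>+\<omega>. ennreal (t powr \<alpha>) * (g (shift_seq j (\<Theta> \<omega>)) * ennreal (w n (nrm (\<Theta> \<omega> j)))) \<partial>N)"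
    proof (rule nn_integral_cong)
      fix \<omega>
      let ?r = "nrm (\<Theta> \<omega> j)"
      have "t powr \<alpha> * w n ?r = ?r powr -\<alpha> * min 1 ((t * ?r) powr \<alpha>)"
        unfolding w_def t_def by (simp add: powr_divide)
      then have *: "ennreal (t powr \<alpha>) * ennreal (w n ?r)
          = ennreal (?r powr -\<alpha>) * ennreal (min 1 ((t * ?r) powr \<alpha>))"
        by (metis ennreal_mult' powr_ge_zero)
      have "\<phi> (shift_seq j (\<Theta> \<omega>)) = g (shift_seq j (\<Theta> \<omega>)) * ennreal (?r powr -\<alpha>)"
        by (simp add: \<phi>_def shift_seq_def)
      then show "\<phi> (shift_seq j (\<Theta> \<omega>)) * ennreal (min 1 ((t * ?r) powr \<alpha>))
        = ennreal (t powr \<alpha>) * (g (shift_seq j (\<Theta> \<omega>)) * ennreal (w n ?r))"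
        unfolding mult.left_commute[of "ennreal (t powr \<alpha>)" "g _"] * by (simp only: mult.assoc)
    qed
    also have "\<dots> = ennreal (t powr \<alpha>) * ?L"
      by (rule nn_integral_cmult) (simp add: w_def)
    finally have left: "(\<integral>\<^sup>+\<omega>. \<phi> (seq_scale t (shift_seq j (Y \<omega>))) * indicator {\<omega>. t * nrm (Y \<omega> j) > 1} \<omega> \<partial>N)
      = ennreal (t powr \<alpha>) * ?L" .
    have "(\<integral>\<^sup>+\<omega>. \<phi> (Y \<omega>) * indicator {\<omega>. nrm (Y \<omega> (-j)) > t} \<omega> \<partial>N)
       = (\<integral>\<^sup>+\<omega>. \<phi> (\<Theta> \<omega>) * indicator {\<omega>. nrm (Y \<omega> 0) * (real (Suc n) * nrm (\<Theta> \<omega> (-j))) > 1} \<omega> \<partial>N)"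
    proof (rule nn_integral_cong_AE, rule AE_mp[OF nrm_Y0_gt_1], rule AE_I2, rule impI)
      fix \<omega> assume Y0: "nrm (Y \<omega> 0) > 1"
      have "\<phi> (Y \<omega>) = \<phi> (\<Theta> \<omega>)"
        using Y0 by (subst Y_eq_scale_\<Theta>[OF Y0]) (simp add: \<phi>_scale)
      moreover have "nrm (Y \<omega> (-j)) = nrm (Y \<omega> 0) * nrm (\<Theta> \<omega> (-j))"
        by (subst Y_eq_scale_\<Theta>[OF Y0]) (simp add: seq_scale_def)
      moreover have "r > t \<longleftrightarrow> real (Suc n) * r > 1" for r
        unfolding t_def by (simp add: field_simps)
      ultimately show "\<phi> (Y \<omega>) * indicator {\<omega>. nrm (Y \<omega> (-j)) > t} \<omega>
        = \<phi> (\<Theta> \<omega>) * indicator {\<omega>. nrm (Y \<omega> 0) * (real (Suc n) * nrm (\<Theta> \<omega> (-j))) > 1} \<omega>"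
        by (simp add: indicator_def mult_ac del: of_nat_Suc)
    qed
    also have "\<dots> = (\<integral>\<^sup>+\<omega>. \<phi> (\<Theta> \<omega>) * ennreal (min 1 ((real (Suc n) * nrm (\<Theta> \<omega> (-j))) powr \<alpha>)) \<partial>N)"
      by (intro polar_gt[of \<phi> "\<lambda>x. real (Suc n) * nrm (x (-j))"]) auto
    also have "\<dots> = ?R"
      by (rule nn_integral_cong_AE, rule AE_mp[OF nrm_Y0_gt_1], rule AE_I2)
         (simp add: \<phi>_def v_def nrm_\<Theta>_0)
    finally have right: "(\<integral>\<^sup>+\<omega>. \<phi> (Y \<omega>) * indicator {\<omega>. nrm (Y \<omega> (-j)) > t} \<omega> \<partial>N) = ?R" .
    have "ennreal (t powr \<alpha>) * ?L = ennreal (t powr \<alpha>) * ?R"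
      using time_change[OF t \<phi>, of j] unfolding left right .
    then show ?thesis using t by (simp add: ennreal_mult_cancel_left)
  qed
  \<comment> \<open>In this form the weight is visibly monotone in \<open>n\<close>; the definition also covers \<open>r = 0\<close>.\<close>
  have w_eq: "w n r = min ((real (Suc n) / r) powr \<alpha>) 1" if "r > 0" for n r
  proof -
    define c where "c = (real (Suc n) / r) powr \<alpha>"
    define d where "d = (r / real (Suc n)) powr \<alpha>"
    have "c * d = 1"
      unfolding c_def d_def using that by (simp add: powr_divide field_simps)
    have "w n r = c * min 1 d"
      unfolding w_def c_def d_def using that by (simp add: powr_divide powr_minus field_simps)
    also have "\<dots> = min (c * 1) (c * d)"
      by (simp add: min_mult_distrib_left c_def)
    finally show ?thesis using \<open>c * d = 1\<close> by (simp add: c_def)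
  qed
  have w_meas: "w n \<in> borel_measurable borel" and v_meas: "v n \<in> borel_measurable borel" for n
    unfolding w_def v_def by measurable
  have w_mono: "w m r \<le> w n r" if "m \<le> n" "r \<ge> 0" for m n r
  proof (cases "r = 0")
    case False
    with that have r: "r > 0" by simp
    then have "(real (Suc m) / r) powr \<alpha> \<le> (real (Suc n) / r) powr \<alpha>"
      using that \<alpha> by (intro powr_mono2) (auto simp: divide_right_mono)
    then show ?thesis unfolding w_eq[OF r] by (rule min.mono) simp
  qed (simp add: w_def)
  have v_mono: "v m r \<le> v n r" if "m \<le> n" "r \<ge> 0" for m n r
    unfolding v_def using that \<alpha>
    by (intro min.mono powr_mono2 mult_right_mono) auto
  have ge_one: "eventually (\<lambda>n. real (Suc n) * c \<ge> 1) sequentially" if "c > 0" for c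
  proof -
    obtain n0 :: nat where "1 / c < real n0" using reals_Archimedean2 by blast
    then have "1 \<le> real (Suc n) * c" if "n \<ge> n0" for n
    proof -
      have "1 / c \<le> real (Suc n)" using that \<open>1 / c < real n0\<close> by linarith
      then show ?thesis using \<open>c > 0\<close> by (simp add: divide_le_eq)
    qed
    then show ?thesis by (auto simp: eventually_sequentially)
  qed
  have w_lim: "eventually (\<lambda>n. ennreal (w n (nrm x)) = indicator {x. x \<noteq> 0} x) sequentially" for x
  proof (cases "x = 0")
    case False
    then have r: "nrm x > 0" using nrm_nonneg[of x] by (simp add: less_le)
    then have "1 / nrm x > 0" by simp
    from ge_one[OF this] have "eventually (\<lambda>n. w n (nrm x) = 1) sequentially"
      by eventually_elim (use \<alpha> in \<open>simp add: w_eq[OF r] ge_one_powr_ge_zero min_absorb2 del: of_nat_Suc\<close>)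
    then show ?thesis by eventually_elim (use False in simp)
  qed (simp add: w_def)
  have v_lim: "eventually (\<lambda>n. ennreal (v n (nrm x)) = indicator {x. x \<noteq> 0} x) sequentially" for x
  proof (cases "x = 0")
    case False
    then have r: "nrm x > 0" using nrm_nonneg[of x] by (simp add: less_le)
    from ge_one[OF this] have "eventually (\<lambda>n. v n (nrm x) = 1) sequentially"
      by eventually_elim (use \<alpha> in \<open>simp add: v_def ge_one_powr_ge_zero min_absorb1 del: of_nat_Suc\<close>)
    then show ?thesis by eventually_elim (use False in simp)
  qed (simp add: v_def)
  have lim: "(\<lambda>n. \<integral>\<^sup>+\<omega>. G (\<Theta> \<omega>) * ennreal (u n (nrm (\<Theta> \<omega> i))) \<partial>N)
      \<longlonglongrightarrow> (\<integral>\<^sup>+\<omega>. G (\<Theta> \<omega>) * indicator {\<omega>. \<Theta> \<omega> i \<noteq> 0} \<omega> \<partial>N)"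
    if [measurable]: "G \<in> borel_measurable borel" "\<And>n. u n \<in> borel_measurable borel"
      and mono: "\<And>m n r. m \<le> n \<Longrightarrow> r \<ge> 0 \<Longrightarrow> u m r \<le> (u n r :: real)"
      and lim: "\<And>x. eventually (\<lambda>n. ennreal (u n (nrm x)) = indicator {x. x \<noteq> 0} x) sequentially"
    for G i and u :: "nat \<Rightarrow> real \<Rightarrow> real"
  proof (rule nn_integral_LIMSEQ)
    show "incseq (\<lambda>n \<omega>. G (\<Theta> \<omega>) * ennreal (u n (nrm (\<Theta> \<omega> i))))"
      by (auto intro!: incseq_SucI le_funI mult_left_mono ennreal_leI mono)
    show "(\<lambda>n. G (\<Theta> \<omega>) * ennreal (u n (nrm (\<Theta> \<omega> i)))) \<longlonglongrightarrow> G (\<Theta> \<omega>) * indicator {\<omega>. \<Theta> \<omega> i \<noteq> 0} \<omega>" for \<omega>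
    proof (rule tendsto_eventually)
      show "eventually (\<lambda>n. G (\<Theta> \<omega>) * ennreal (u n (nrm (\<Theta> \<omega> i)))
          = G (\<Theta> \<omega>) * indicator {\<omega>. \<Theta> \<omega> i \<noteq> 0} \<omega>) sequentially"
        using lim[of "\<Theta> \<omega> i"] by eventually_elim (simp add: indicator_def)
    qed
  qed measurable
  have "(\<lambda>n. \<integral>\<^sup>+\<omega>. g (shift_seq j (\<Theta> \<omega>)) * ennreal (w n (nrm (\<Theta> \<omega> j))) \<partial>N)
      \<longlonglongrightarrow> (\<integral>\<^sup>+\<omega>. g (shift_seq j (\<Theta> \<omega>)) * indicator {\<omega>. \<Theta> \<omega> j \<noteq> 0} \<omega> \<partial>N)"
    by (rule lim[of "\<lambda>x. g (shift_seq j x)"]) (auto intro: w_meas w_lim w_mono)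
  moreover have "(\<lambda>n. \<integral>\<^sup>+\<omega>. g (\<Theta> \<omega>) * ennreal (v n (nrm (\<Theta> \<omega> (-j)))) \<partial>N)
      \<longlonglongrightarrow> (\<integral>\<^sup>+\<omega>. g (\<Theta> \<omega>) * indicator {\<omega>. \<Theta> \<omega> (-j) \<noteq> 0} \<omega> \<partial>N)"
    by (rule lim) (auto intro: v_meas v_lim v_mono)
  ultimately show ?thesis
    unfolding step by (rule LIMSEQ_unique)
qed

end

section \<open>Telescoping sums and suprema along orbits\<close>

lemma sum_telescope_symmetric:
  fixes f :: "int \<Rightarrow> 'b::ab_group_add"
  shows "(\<Sum>j\<in>{-int n..<int n}. f j - f (j + 1)) = f (- int n) - f (int n)"
proof (induction n)
  case (Suc n)
  have "{-int (Suc n)..<int (Suc n)} = insert (-int n - 1) (insert (int n) {-int n..<int n})"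
    by auto
  moreover have "f (- 1 - int n) = f (- int n - 1)" by (rule arg_cong[of _ _ f]) simp
  ultimately show ?case by (simp add: Suc algebra_simps)
qed simp

lemma SUP_sum_telescope:
  fixes f :: "int \<Rightarrow> real"
  assumes mono: "\<And>j. f (j + 1) \<le> f j"
    and a: "(\<lambda>n. f (- int n)) \<longlonglongrightarrow> a" and b: "(\<lambda>n. f (int n)) \<longlonglongrightarrow> b"
  shows "(SUP n. \<Sum>j\<in>{-int n..<int n}. ennreal (f j - f (j + 1))) = ennreal (a - b)"
proof (rule LIMSEQ_unique[OF LIMSEQ_SUP])
  show "incseq (\<lambda>n. \<Sum>j\<in>{-int n..<int n}. ennreal (f j - f (j + 1)))"
    by (auto intro!: incseq_SucI sum_mono2)
  have "(\<Sum>j\<in>{-int n..<int n}. ennreal (f j - f (j + 1))) = ennreal (f (- int n) - f (int n))" for n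
    using mono by (simp add: sum_ennreal sum_telescope_symmetric)
  then show "(\<lambda>n. \<Sum>j\<in>{-int n..<int n}. ennreal (f j - f (j + 1))) \<longlonglongrightarrow> ennreal (a - b)"
    using a b by (auto intro!: tendsto_intros)
qed

text \<open>
  The sum of \<open>K\<close> over the shift orbit of \<open>x\<close>. For nonnegative terms the supremum over symmetric
  windows is the unordered sum, and it suits both telescoping and monotone convergence.
\<close>

definition orbit_sum :: "((int \<Rightarrow> 'a) \<Rightarrow> ennreal) \<Rightarrow> (int \<Rightarrow> 'a) \<Rightarrow> ennreal" where
  "orbit_sum K x = (SUP n. \<Sum>j\<in>{-int n..<int n}. K (shift_seq j x))"

lemma incseq_orbit_partial:
  fixes K :: "(int \<Rightarrow> 'a) \<Rightarrow> ennreal"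
  shows "incseq (\<lambda>n. \<Sum>j\<in>{-int n..<int n}. K (shift_seq j x))"
  by (auto intro!: incseq_SucI sum_mono2)

lemma orbit_sum_measurable [measurable]:
  fixes K :: "(int \<Rightarrow> 'a::euclidean_space) \<Rightarrow> ennreal"
  assumes [measurable]: "K \<in> borel_measurable borel"
  shows "orbit_sum K \<in> borel_measurable borel"
  unfolding orbit_sum_def[abs_def] by measurable

text \<open>
  The value is \<open>0\<close> for an infinite supremum; thereby homogeneity of the supremum holds for all
  sequences, and not just for bounded ones.
\<close>

definition sup_norm :: "('a \<Rightarrow> real) \<Rightarrow> int set \<Rightarrow> (int \<Rightarrow> 'a) \<Rightarrow> real" where
  "sup_norm nrm J x = enn2real (seq_sup nrm J x)"

lemma sup_norm_nonneg [simp]: "0 \<le> sup_norm nrm J x"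
  by (simp add: sup_norm_def)

lemma seq_sup_shift: "seq_sup nrm J (shift_seq j x) = seq_sup nrm ((\<lambda>i. i + j) ` J) x"
  by (simp add: seq_sup_def shift_seq_def image_image)

lemma sup_norm_shift:
  "sup_norm nrm {..i} (shift_seq j x) = sup_norm nrm {..i + j} x"
  "sup_norm nrm {i..} (shift_seq j x) = sup_norm nrm {i + j..} x"
  "sup_norm nrm UNIV (shift_seq j x) = sup_norm nrm UNIV x"
proof -
  have "(\<lambda>k. k + j) ` {..i} = {..i + j}" "(\<lambda>k. k + j) ` {i..} = {i + j..}" "range (\<lambda>k. k + j) = UNIV"
    by (auto intro: image_eqI[of _ _ "_ - j"])
  then show "sup_norm nrm {..i} (shift_seq j x) = sup_norm nrm {..i + j} x"
    "sup_norm nrm {i..} (shift_seq j x) = sup_norm nrm {i + j..} x"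
    "sup_norm nrm UNIV (shift_seq j x) = sup_norm nrm UNIV x"
    by (simp_all add: sup_norm_def seq_sup_shift)
qed

lemma sup_norm_least:
  assumes "\<And>j. j \<in> J \<Longrightarrow> nrm (x j) \<le> c" "0 \<le> c"
  shows "sup_norm nrm J x \<le> c"
proof -
  have "seq_sup nrm J x \<le> ennreal c"
    unfolding seq_sup_def using assms by (intro SUP_least ennreal_leI) auto
  then show ?thesis unfolding sup_norm_def using assms(2) by (simp add: enn2real_leI)
qed

definition vanishing :: "('a \<Rightarrow> real) \<Rightarrow> (int \<Rightarrow> 'a) \<Rightarrow> bool" where
  "vanishing nrm x \<longleftrightarrow> ((\<lambda>j. nrm (x j)) \<longlongrightarrow> 0) (filtercomap abs at_top)"

lemma vanishing_bound:
  assumes "vanishing nrm x" "e > 0"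
  obtains n0 :: nat where "\<And>j. int n0 \<le> \<bar>j\<bar> \<Longrightarrow> nrm (x j) < e"
proof -
  have "eventually (\<lambda>j. nrm (x j) < e) (filtercomap abs at_top)"
    using assms order_tendstoD(2) unfolding vanishing_def by blast
  then obtain b :: int where b: "\<And>j. b \<le> \<bar>j\<bar> \<Longrightarrow> nrm (x j) < e"
    by (auto simp: eventually_filtercomap eventually_at_top_linorder)
  show ?thesis by (rule that[of "nat b"], rule b) (simp split: if_splits)
qed

context
  fixes nrm :: "'a \<Rightarrow> real" and x :: "int \<Rightarrow> 'a"
  assumes van: "vanishing nrm x"
begin

lemma seq_sup_vanishing: "seq_sup nrm J x = ennreal (sup_norm nrm J x)"
proof -
  obtain n0 :: nat where n0: "\<And>j. int n0 \<le> \<bar>j\<bar> \<Longrightarrow> nrm (x j) < 1"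
    using vanishing_bound[OF van, of 1] by auto
  define c where "c = Max (insert 1 ((\<lambda>j. nrm (x j)) ` {-int n0..int n0}))"
  have "nrm (x j) \<le> c" for j
  proof (cases "int n0 \<le> \<bar>j\<bar>")
    case True
    have "1 \<le> c" unfolding c_def by (rule Max_ge) auto
    with n0[OF True] show ?thesis by simp
  next
    case False
    then have "j \<in> {-int n0..int n0}" by auto
    then show ?thesis unfolding c_def by (intro Max_ge) auto
  qed
  then have "seq_sup nrm J x \<le> ennreal c"
    unfolding seq_sup_def by (intro SUP_least ennreal_leI)
  then show ?thesis
    unfolding sup_norm_def by (simp add: order_le_less_trans)
qed

lemma sup_norm_mono: "J \<subseteq> K \<Longrightarrow> sup_norm nrm J x \<le> sup_norm nrm K x"
proof -
  assume "J \<subseteq> K"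
  then have "seq_sup nrm J x \<le> seq_sup nrm K x" unfolding seq_sup_def by (rule SUP_subset_mono) simp
  then show ?thesis by (simp add: seq_sup_vanishing)
qed

lemma sup_norm_upper: "j \<in> J \<Longrightarrow> nrm (x j) \<le> sup_norm nrm J x"
proof -
  assume "j \<in> J"
  then have "ennreal (nrm (x j)) \<le> seq_sup nrm J x" unfolding seq_sup_def by (rule SUP_upper)
  then show ?thesis by (simp add: seq_sup_vanishing)
qed

lemma sup_norm_Un: "sup_norm nrm (J \<union> K) x = max (sup_norm nrm J x) (sup_norm nrm K x)"
proof (rule antisym)
  show "sup_norm nrm (J \<union> K) x \<le> max (sup_norm nrm J x) (sup_norm nrm K x)"
    by (rule sup_norm_least) (auto simp: le_max_iff_disj sup_norm_upper)
qed (simp add: sup_norm_mono)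

lemma sup_norm_tails:
  "(\<lambda>n. sup_norm nrm {..- int n} x) \<longlonglongrightarrow> 0" "(\<lambda>n. sup_norm nrm {int n..} x) \<longlonglongrightarrow> 0"
proof -
  have "\<exists>n0. \<forall>n\<ge>n0. sup_norm nrm {..- int n} x \<le> e \<and> sup_norm nrm {int n..} x \<le> e" if "e > 0" for e
  proof -
    obtain n0 :: nat where "\<And>j. int n0 \<le> \<bar>j\<bar> \<Longrightarrow> nrm (x j) < e"
      using vanishing_bound[OF van \<open>e > 0\<close>] by blast
    then show ?thesis
      using that by (intro exI[of _ n0] allI impI conjI sup_norm_least) (auto intro!: less_imp_le)
  qed
  then show "(\<lambda>n. sup_norm nrm {..- int n} x) \<longlonglongrightarrow> 0" "(\<lambda>n. sup_norm nrm {int n..} x) \<longlonglongrightarrow> 0"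
    by (intro LIMSEQ_I, force dest: spec[of _ "_ / 2"])+
qed

lemma sup_norm_exhaust:
  "(\<lambda>n. sup_norm nrm {..int n} x) \<longlonglongrightarrow> sup_norm nrm UNIV x"
  "(\<lambda>n. sup_norm nrm {- int n..} x) \<longlonglongrightarrow> sup_norm nrm UNIV x"
proof -
  have u: "sup_norm nrm UNIV x \<le> sup_norm nrm J x + sup_norm nrm K x" if "J \<union> K = UNIV" for J K
    using sup_norm_Un[of J K] sup_norm_nonneg[of nrm J x] sup_norm_nonneg[of nrm K x]
    unfolding that by linarith
  have cover: "{..int n} \<union> {int n..} = UNIV" "{- int n..} \<union> {..- int n} = UNIV" for n by auto
  have "(\<lambda>n. sup_norm nrm UNIV x - sup_norm nrm {int n..} x) \<longlonglongrightarrow> sup_norm nrm UNIV x"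
    using tendsto_diff[OF tendsto_const sup_norm_tails(2)] by simp
  from tendsto_sandwich[OF _ _ this tendsto_const]
  show "(\<lambda>n. sup_norm nrm {..int n} x) \<longlonglongrightarrow> sup_norm nrm UNIV x"
    using u[OF cover(1)] by (auto simp: sup_norm_mono algebra_simps)
  have "(\<lambda>n. sup_norm nrm UNIV x - sup_norm nrm {..- int n} x) \<longlonglongrightarrow> sup_norm nrm UNIV x"
    using tendsto_diff[OF tendsto_const sup_norm_tails(1)] by simp
  from tendsto_sandwich[OF _ _ this tendsto_const]
  show "(\<lambda>n. sup_norm nrm {- int n..} x) \<longlonglongrightarrow> sup_norm nrm UNIV x"
    using u[OF cover(2)] by (auto simp: sup_norm_mono algebra_simps)
qed

end

context tail_process_of_stationary
begin

lemma seq_sup_measurable [measurable]: "seq_sup nrm J \<in> borel_measurable borel"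
proof -
  have [measurable]: "(\<lambda>x :: int \<Rightarrow> 'a. x i) \<in> borel_measurable borel" for i
    by (rule measurable_product_coordinates)
  show ?thesis unfolding seq_sup_def[abs_def] by measurable
qed

lemma sup_norm_measurable [measurable]: "sup_norm nrm J \<in> borel_measurable borel"
  unfolding sup_norm_def[abs_def] by measurable

lemma seq_sup_scale: "c \<ge> 0 \<Longrightarrow> seq_sup nrm J (seq_scale c x) = ennreal c * seq_sup nrm J x"
  by (simp add: seq_sup_def seq_scale_def SUP_mult_left_ennreal ennreal_mult')

lemma sup_norm_scale: "c \<ge> 0 \<Longrightarrow> sup_norm nrm J (seq_scale c x) = c * sup_norm nrm J x"
  by (simp add: sup_norm_def seq_sup_scale enn2real_mult)

lemma vanishing_scale: "vanishing nrm x \<Longrightarrow> vanishing nrm (seq_scale c x)"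
  unfolding vanishing_def seq_scale_def nrm_scale by (rule tendsto_mult_right_zero)

lemma sup_norm_insert_zero:
  "x i = 0 \<Longrightarrow> sup_norm nrm (insert i J) x = sup_norm nrm J x"
  by (simp add: sup_norm_def seq_sup_def SUP_insert bot_ennreal[symmetric] del: SUP_insert)

end

section \<open>Mass transport and the extremal index\<close>

locale vanishing_tail_process = tail_process_of_stationary nrm \<alpha> M X N Y
  for nrm :: "'a::euclidean_space \<Rightarrow> real" and \<alpha> :: real
    and M :: "'w measure" and X :: "'w \<Rightarrow> int \<Rightarrow> 'a"
    and N :: "'v measure" and Y :: "'v \<Rightarrow> int \<Rightarrow> 'a" +
  assumes vanish: "AE \<omega> in N. vanishing nrm (Y \<omega>)"
begin

definition normalized_Y :: "'v \<Rightarrow> int \<Rightarrow> 'a" where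
  "normalized_Y \<omega> = seq_scale (1 / sup_norm nrm UNIV (Y \<omega>)) (Y \<omega>)"

definition no_past_exceedance :: "'v set" where
  "no_past_exceedance = {\<omega> \<in> space N. seq_sup nrm {..-1} (Y \<omega>) \<le> 1}"

lemma normalized_Y_measurable [measurable]: "normalized_Y \<in> borel_measurable N"
  unfolding normalized_Y_def[abs_def] by measurable

lemma no_past_exceedance_sets [measurable]: "no_past_exceedance \<in> sets N"
  unfolding no_past_exceedance_def by measurable

lemma good_path:
  "AE \<omega> in N. nrm (Y \<omega> 0) > 1 \<and> vanishing nrm (\<Theta> \<omega>) \<and> vanishing nrm (Y \<omega>)"
  using vanish nrm_Y0_gt_1
  by eventually_elim (simp add: spectral_def vanishing_scale)

text \<open>
  Pathwise dictionary between \<open>Y\<close>, its normalization by the supremum, and \<open>\<Theta>\<close>.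
\<close>

lemma sup_norm_Y:
  assumes "nrm (Y \<omega> 0) > 1"
  shows "sup_norm nrm J (Y \<omega>) = nrm (Y \<omega> 0) * sup_norm nrm J (\<Theta> \<omega>)"
  by (subst Y_eq_scale_\<Theta>[OF assms]) (use assms in \<open>simp add: sup_norm_scale\<close>)

lemma sup_norm_\<Theta>_pos:
  assumes "nrm (Y \<omega> 0) > 1" "vanishing nrm (\<Theta> \<omega>)" "0 \<in> J"
  shows "sup_norm nrm J (\<Theta> \<omega>) \<ge> 1"
  using sup_norm_upper[OF assms(2,3)] nrm_\<Theta>_0[OF assms(1)] by simp

lemma normalized_Y_eq_scale_\<Theta>:
  assumes "nrm (Y \<omega> 0) > 1"
  shows "normalized_Y \<omega> = seq_scale (1 / sup_norm nrm UNIV (\<Theta> \<omega>)) (\<Theta> \<omega>)"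
  unfolding normalized_Y_def sup_norm_Y[OF assms]
  by (subst (3) Y_eq_scale_\<Theta>[OF assms])
     (use assms in \<open>cases "Y \<omega> 0 = 0"; simp add: seq_scale_def\<close>)

lemma seq_sup_Y_le_1_iff:
  assumes "nrm (Y \<omega> 0) > 1" "vanishing nrm (Y \<omega>)"
  shows "seq_sup nrm J (Y \<omega>) \<le> 1 \<longleftrightarrow> nrm (Y \<omega> 0) * sup_norm nrm J (\<Theta> \<omega>) \<le> 1"
  unfolding seq_sup_vanishing[OF assms(2)] sup_norm_Y[OF assms(1)]
  by (simp add: ennreal_le_1)

text \<open>
  The relative increase of the running supremum (to the power \<open>\<alpha>\<close>, started at \<open>-\<infinity>\<close>) at time \<open>0\<close>.
  At \<open>\<Theta>\<close> it is the conditional probability of no exceedance before time \<open>0\<close>, given \<open>\<Theta>\<close>,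
  divided by the power \<open>\<alpha>\<close> of the overall supremum.
\<close>

definition record_weight :: "(int \<Rightarrow> 'a) \<Rightarrow> ennreal" where
  "record_weight x = ennreal ((sup_norm nrm {..0} x powr \<alpha> - sup_norm nrm {..-1} x powr \<alpha>) / sup_norm nrm UNIV x powr \<alpha>)"

lemma record_weight_measurable [measurable]: "record_weight \<in> borel_measurable borel"
  unfolding record_weight_def[abs_def] by measurable

lemma record_weight_scale:
  assumes "c > 0"
  shows "record_weight (seq_scale c x) = record_weight x"
proof -
  have "c powr \<alpha> \<noteq> 0" using assms by simp
  then show ?thesis
    unfolding record_weight_def using assms
    by (simp add: sup_norm_scale powr_mult flip: right_diff_distrib)
qed

lemma record_weight_zero: "x 0 = 0 \<Longrightarrow> record_weight x = 0"
proof -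
  assume "x 0 = 0"
  moreover have "{..0::int} = insert 0 {..-1}" by auto
  ultimately show ?thesis by (simp add: record_weight_def sup_norm_insert_zero)
qed

lemma max_powr_diff:
  assumes "m \<ge> 0"
  shows "max 1 m powr \<alpha> - m powr \<alpha> = 1 - min 1 (m powr \<alpha>)"
proof (cases "m \<le> 1")
  case True
  then have "m powr \<alpha> \<le> 1" using assms \<alpha> by (simp add: powr_le1)
  with True show ?thesis by (simp add: max_def)
next
  case False
  then have "m powr \<alpha> \<ge> 1" using \<alpha> by (simp add: ge_one_powr_ge_zero)
  with False show ?thesis by simp
qed

text \<open>
  Mass transport. The path \<open>normalized_Y\<close> is a multiple of \<open>\<Theta>\<close>, and given \<open>\<Theta>\<close> the event that
  no exceedance precedes time \<open>0\<close> has probability \<open>1 - min 1 (m\<^sup>\<alpha>)\<close> with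
  \<open>m = sup\<^bsub>i<0\<^esub> |\<Theta>\<^sub>i|\<close>. Hence the left-hand side is the expectation of
  \<open>K(shift_seq j \<Theta>) record_weight(\<Theta>)\<close>, and the time change moves the shift from \<open>K\<close> to the weight:
  the product \<open>K(x) record_weight(shift_seq (-j) x)\<close> is \<open>\<alpha>\<close>-homogeneous and vanishes as soon as
  coordinate \<open>0\<close> or \<open>-j\<close> does, so both indicators in the time change formula equal \<open>1\<close> where the
  integrands do not vanish.
\<close>

lemma nn_integral_anchored_term:
  fixes K :: "(int \<Rightarrow> 'a) \<Rightarrow> ennreal"
  assumes K [measurable]: "K \<in> borel_measurable borel"
    and hom: "\<And>c x. c > 0 \<Longrightarrow> K (seq_scale c x) = ennreal (c powr \<alpha>) * K x"
    and zero: "\<And>x. x 0 = 0 \<Longrightarrow> K x = 0"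
  shows "(\<integral>\<^sup>+\<omega>. K (shift_seq j (normalized_Y \<omega>)) * indicator no_past_exceedance \<omega> \<partial>N)
       = (\<integral>\<^sup>+\<omega>. K (\<Theta> \<omega>) * record_weight (shift_seq (-j) (\<Theta> \<omega>)) \<partial>N)"
proof -
  define \<psi> where "\<psi> = (\<lambda>x. ennreal ((1 / sup_norm nrm UNIV x) powr \<alpha>) * K (shift_seq j x))"
  have [measurable]: "\<psi> \<in> borel_measurable borel" unfolding \<psi>_def by measurable
  let ?m = "sup_norm nrm {..-1}"
  have "(\<integral>\<^sup>+\<omega>. K (shift_seq j (normalized_Y \<omega>)) * indicator no_past_exceedance \<omega> \<partial>N)
     = (\<integral>\<^sup>+\<omega>. \<psi> (\<Theta> \<omega>) * indicator {\<omega>. nrm (Y \<omega> 0) * ?m (\<Theta> \<omega>) \<le> 1} \<omega> \<partial>N)"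
  proof (rule nn_integral_cong_AE, rule AE_mp[OF good_path], rule AE_I2, rule impI)
    fix \<omega> assume \<omega>: "\<omega> \<in> space N" and *: "nrm (Y \<omega> 0) > 1 \<and> vanishing nrm (\<Theta> \<omega>) \<and> vanishing nrm (Y \<omega>)"
    have pos: "sup_norm nrm UNIV (\<Theta> \<omega>) > 0"
      using sup_norm_\<Theta>_pos[of \<omega> UNIV] * by simp
    have "shift_seq j (normalized_Y \<omega>) = seq_scale (1 / sup_norm nrm UNIV (\<Theta> \<omega>)) (shift_seq j (\<Theta> \<omega>))"
      using * by (simp add: normalized_Y_eq_scale_\<Theta> shift_seq_def seq_scale_def)
    then have "K (shift_seq j (normalized_Y \<omega>)) = \<psi> (\<Theta> \<omega>)"
      unfolding \<psi>_def using pos by (simp add: hom)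
    moreover have "indicator no_past_exceedance \<omega> = (indicator {\<omega>. nrm (Y \<omega> 0) * ?m (\<Theta> \<omega>) \<le> 1} \<omega> :: ennreal)"
      using seq_sup_Y_le_1_iff[of \<omega> "{..-1}"] * \<omega> by (simp add: no_past_exceedance_def indicator_def)
    ultimately show "K (shift_seq j (normalized_Y \<omega>)) * indicator no_past_exceedance \<omega>
      = \<psi> (\<Theta> \<omega>) * indicator {\<omega>. nrm (Y \<omega> 0) * ?m (\<Theta> \<omega>) \<le> 1} \<omega>" by simp
  qed
  also have "\<dots> = (\<integral>\<^sup>+\<omega>. \<psi> (\<Theta> \<omega>) * ennreal (1 - min 1 (?m (\<Theta> \<omega>) powr \<alpha>)) \<partial>N)"
    by (rule polar_le) auto
  also have "\<dots> = (\<integral>\<^sup>+\<omega>. K (shift_seq j (\<Theta> \<omega>)) * record_weight (\<Theta> \<omega>) \<partial>N)"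
  proof (rule nn_integral_cong_AE, rule AE_mp[OF good_path], rule AE_I2, rule impI)
    fix \<omega> assume *: "nrm (Y \<omega> 0) > 1 \<and> vanishing nrm (\<Theta> \<omega>) \<and> vanishing nrm (Y \<omega>)"
    have van: "vanishing nrm (\<Theta> \<omega>)" using * by simp
    have "sup_norm nrm {0} (\<Theta> \<omega>) = 1"
      using * by (simp add: sup_norm_def seq_sup_def nrm_\<Theta>_0)
    moreover have "{..0::int} = {0} \<union> {..-1}" by auto
    ultimately have "sup_norm nrm {..0} (\<Theta> \<omega>) = max 1 (?m (\<Theta> \<omega>))"
      using sup_norm_Un[OF van, of "{0}" "{..-1}"] by simp
    then have "record_weight (\<Theta> \<omega>) = ennreal ((1 / sup_norm nrm UNIV (\<Theta> \<omega>)) powr \<alpha> * (1 - min 1 (?m (\<Theta> \<omega>) powr \<alpha>)))"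
      unfolding record_weight_def by (simp add: max_powr_diff powr_divide)
    also have "\<dots> = ennreal ((1 / sup_norm nrm UNIV (\<Theta> \<omega>)) powr \<alpha>) * ennreal (1 - min 1 (?m (\<Theta> \<omega>) powr \<alpha>))"
      by (rule ennreal_mult) auto
    finally show "\<psi> (\<Theta> \<omega>) * ennreal (1 - min 1 (?m (\<Theta> \<omega>) powr \<alpha>)) = K (shift_seq j (\<Theta> \<omega>)) * record_weight (\<Theta> \<omega>)"
      by (simp only: \<psi>_def mult_ac)
  qed
  also have "\<dots> = (\<integral>\<^sup>+\<omega>. K (\<Theta> \<omega>) * record_weight (shift_seq (-j) (\<Theta> \<omega>)) \<partial>N)"
  proof -
    define g where "g = (\<lambda>x. K x * record_weight (shift_seq (-j) x))"
    have g: "g \<in> borel_measurable borel" unfolding g_def by measurable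
    have g_hom: "g (seq_scale c x) = ennreal (c powr \<alpha>) * g x" if "c > 0" for c x
    proof -
      have "shift_seq (-j) (seq_scale c x) = seq_scale c (shift_seq (-j) x)"
        by (simp add: shift_seq_def seq_scale_def)
      then show ?thesis unfolding g_def by (simp add: hom[OF that] record_weight_scale[OF that] mult.assoc)
    qed
    have "shift_seq (-j) (shift_seq j x) = x" for x :: "int \<Rightarrow> 'a" by (simp add: shift_seq_def)
    then have "(\<integral>\<^sup>+\<omega>. K (shift_seq j (\<Theta> \<omega>)) * record_weight (\<Theta> \<omega>) \<partial>N)
        = (\<integral>\<^sup>+\<omega>. g (shift_seq j (\<Theta> \<omega>)) * indicator {\<omega>. \<Theta> \<omega> j \<noteq> 0} \<omega> \<partial>N)"
      by (intro nn_integral_cong) (simp add: g_def zero shift_seq_def indicator_def)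
    also have "\<dots> = (\<integral>\<^sup>+\<omega>. g (\<Theta> \<omega>) * indicator {\<omega>. \<Theta> \<omega> (-j) \<noteq> 0} \<omega> \<partial>N)"
      by (rule spectral_time_change[OF g g_hom])
    also have "\<dots> = (\<integral>\<^sup>+\<omega>. K (\<Theta> \<omega>) * record_weight (shift_seq (-j) (\<Theta> \<omega>)) \<partial>N)"
      by (intro nn_integral_cong) (simp add: g_def record_weight_zero shift_seq_def indicator_def)
    finally show ?thesis .
  qed
  finally show ?thesis .
qed

text \<open>
  The running supremum climbs from \<open>0\<close> to the overall supremum, so its relative increments sum to \<open>1\<close>.
\<close>

lemma record_weight_partition_of_unity:
  assumes "vanishing nrm x" "sup_norm nrm UNIV x > 0"
  shows "(SUP n. \<Sum>j\<in>{-int n..<int n}. record_weight (shift_seq (-j) x)) = 1"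
proof -
  let ?s = "sup_norm nrm UNIV x"
  define f where "f = (\<lambda>j::int. (sup_norm nrm {..-j} x / ?s) powr \<alpha>)"
  have record_weight_eq: "record_weight (shift_seq (-j) x) = ennreal (f j - f (j + 1))" for j
    unfolding record_weight_def f_def
    by (simp add: sup_norm_shift powr_divide diff_divide_distrib add.commute)
  have "(SUP n. \<Sum>j\<in>{-int n..<int n}. ennreal (f j - f (j + 1))) = ennreal (1 - 0)"
  proof (rule SUP_sum_telescope)
    show "f (j + 1) \<le> f j" for j
      unfolding f_def using assms \<alpha>
      by (intro powr_mono2 divide_right_mono sup_norm_mono[OF assms(1)]) auto
    have "(\<lambda>n. f (- int n)) \<longlonglongrightarrow> (?s / ?s) powr \<alpha>"
      unfolding f_def minus_minus using assms(2)
      by (intro tendsto_intros sup_norm_exhaust[OF assms(1)]) auto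
    then show "(\<lambda>n. f (- int n)) \<longlonglongrightarrow> 1" using assms(2) by simp
    have "(\<lambda>n. f (int n)) \<longlonglongrightarrow> (0 / ?s) powr \<alpha>"
      unfolding f_def using assms(2) \<alpha>
      by (intro tendsto_powr' tendsto_intros sup_norm_tails[OF assms(1)]) auto
    then show "(\<lambda>n. f (int n)) \<longlonglongrightarrow> 0" by simp
  qed
  then show ?thesis by (simp add: record_weight_eq)
qed

text \<open>
  Summing the mass transport identity over \<open>j\<close>: on the left the shifts of \<open>K\<close> are collected in an
  orbit sum, on the right the weights add up to \<open>1\<close>.
\<close>

theorem nn_integral_orbit_sum:
  fixes K :: "(int \<Rightarrow> 'a) \<Rightarrow> ennreal"
  assumes K [measurable]: "K \<in> borel_measurable borel"
    and hom: "\<And>c x. c > 0 \<Longrightarrow> K (seq_scale c x) = ennreal (c powr \<alpha>) * K x"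
    and zero: "\<And>x. x 0 = 0 \<Longrightarrow> K x = 0"
  shows "(\<integral>\<^sup>+\<omega>. orbit_sum K (normalized_Y \<omega>) * indicator no_past_exceedance \<omega> \<partial>N) = (\<integral>\<^sup>+\<omega>. K (\<Theta> \<omega>) \<partial>N)"
proof -
  let ?J = "\<lambda>n. {-int n..<int n}"
  have "(\<integral>\<^sup>+\<omega>. orbit_sum K (normalized_Y \<omega>) * indicator no_past_exceedance \<omega> \<partial>N)
     = (\<integral>\<^sup>+\<omega>. (SUP n. (\<Sum>j\<in>?J n. K (shift_seq j (normalized_Y \<omega>))) * indicator no_past_exceedance \<omega>) \<partial>N)"
    by (simp add: orbit_sum_def SUP_mult_right_ennreal)
  also have "\<dots> = (SUP n. \<integral>\<^sup>+\<omega>. (\<Sum>j\<in>?J n. K (shift_seq j (normalized_Y \<omega>))) * indicator no_past_exceedance \<omega> \<partial>N)"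
  proof (rule nn_integral_monotone_convergence_SUP)
    show "incseq (\<lambda>n \<omega>. (\<Sum>j\<in>?J n. K (shift_seq j (normalized_Y \<omega>))) * indicator no_past_exceedance \<omega>)"
      by (auto intro!: incseq_SucI le_funI mult_right_mono sum_mono2)
  qed measurable
  also have "\<dots> = (SUP n. \<Sum>j\<in>?J n. \<integral>\<^sup>+\<omega>. K (shift_seq j (normalized_Y \<omega>)) * indicator no_past_exceedance \<omega> \<partial>N)"
    unfolding sum_distrib_right by (intro SUP_cong refl nn_integral_sum) measurable
  also have "\<dots> = (SUP n. \<Sum>j\<in>?J n. \<integral>\<^sup>+\<omega>. K (\<Theta> \<omega>) * record_weight (shift_seq (-j) (\<Theta> \<omega>)) \<partial>N)"
    by (simp add: nn_integral_anchored_term[OF K hom zero])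
  also have "\<dots> = (SUP n. \<integral>\<^sup>+\<omega>. K (\<Theta> \<omega>) * (\<Sum>j\<in>?J n. record_weight (shift_seq (-j) (\<Theta> \<omega>))) \<partial>N)"
    by (simp add: sum_distrib_left nn_integral_sum)
  also have "\<dots> = (\<integral>\<^sup>+\<omega>. (SUP n. K (\<Theta> \<omega>) * (\<Sum>j\<in>?J n. record_weight (shift_seq (-j) (\<Theta> \<omega>)))) \<partial>N)"
  proof (rule nn_integral_monotone_convergence_SUP[symmetric])
    show "incseq (\<lambda>n \<omega>. K (\<Theta> \<omega>) * (\<Sum>j\<in>?J n. record_weight (shift_seq (-j) (\<Theta> \<omega>))))"
      by (auto intro!: incseq_SucI le_funI mult_left_mono sum_mono2)
  qed measurable
  also have "\<dots> = (\<integral>\<^sup>+\<omega>. K (\<Theta> \<omega>) \<partial>N)"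
  proof (rule nn_integral_cong_AE, rule AE_mp[OF good_path], rule AE_I2, rule impI)
    fix \<omega> assume *: "nrm (Y \<omega> 0) > 1 \<and> vanishing nrm (\<Theta> \<omega>) \<and> vanishing nrm (Y \<omega>)"
    then have "sup_norm nrm UNIV (\<Theta> \<omega>) > 0" using sup_norm_\<Theta>_pos[of \<omega> UNIV] by simp
    with * show "(SUP n. K (\<Theta> \<omega>) * (\<Sum>j\<in>?J n. record_weight (shift_seq (-j) (\<Theta> \<omega>)))) = K (\<Theta> \<omega>)"
      by (simp add: SUP_mult_left_ennreal[symmetric] record_weight_partition_of_unity)
  qed
  finally show ?thesis .
qed

text \<open>
  Time reversal of the extremal index: \<open>P(sup\<^bsub>i>0\<^esub> |Y\<^sub>i| \<le> 1) = P(sup\<^bsub>i<0\<^esub> |Y\<^sub>i| \<le> 1)\<close>.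
  This is the orbit sum identity for the decrease \<open>K\<close>, at time \<open>0\<close>, of the power \<open>\<alpha>\<close> of
  the supremum over the future, whose orbit sum is the power \<open>\<alpha>\<close> of the overall supremum, hence \<open>1\<close> on normalized paths.
\<close>

lemma extremal_index_eq: "extremal_index nrm N Y = measure N no_past_exceedance"
proof -
  define K where "K = (\<lambda>x. ennreal (sup_norm nrm {0..} x powr \<alpha> - sup_norm nrm {1..} x powr \<alpha>))"
  have K: "K \<in> borel_measurable borel" unfolding K_def by measurable
  have hom: "K (seq_scale c x) = ennreal (c powr \<alpha>) * K x" if "c > 0" for c x
    unfolding K_def using that
    by (simp add: sup_norm_scale powr_mult flip: right_diff_distrib ennreal_mult')
  have zero: "K x = 0" if "x 0 = 0" for x
  proof -
    have "{0::int..} = insert 0 {1..}" by auto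
    then show ?thesis using that by (simp add: K_def sup_norm_insert_zero)
  qed
  let ?m = "sup_norm nrm {1..}"
  have [measurable]: "{\<omega> \<in> space N. seq_sup nrm {1..} (Y \<omega>) \<le> 1} \<in> sets N" by measurable
  have "ennreal (extremal_index nrm N Y) = (\<integral>\<^sup>+\<omega>. indicator {\<omega> \<in> space N. seq_sup nrm {1..} (Y \<omega>) \<le> 1} \<omega> \<partial>N)"
    by (simp add: extremal_index_def N.emeasure_eq_measure)
  also have "\<dots> = (\<integral>\<^sup>+\<omega>. 1 * indicator {\<omega>. nrm (Y \<omega> 0) * ?m (\<Theta> \<omega>) \<le> 1} \<omega> \<partial>N)"
    by (rule nn_integral_cong_AE, rule AE_mp[OF good_path], rule AE_I2)
       (simp add: seq_sup_Y_le_1_iff indicator_def)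
  also have "\<dots> = (\<integral>\<^sup>+\<omega>. 1 * ennreal (1 - min 1 (?m (\<Theta> \<omega>) powr \<alpha>)) \<partial>N)"
    by (rule polar_le) auto
  also have "\<dots> = (\<integral>\<^sup>+\<omega>. K (\<Theta> \<omega>) \<partial>N)"
  proof (rule nn_integral_cong_AE, rule AE_mp[OF good_path], rule AE_I2, rule impI)
    fix \<omega> assume *: "nrm (Y \<omega> 0) > 1 \<and> vanishing nrm (\<Theta> \<omega>) \<and> vanishing nrm (Y \<omega>)"
    then have van: "vanishing nrm (\<Theta> \<omega>)" by simp
    have "sup_norm nrm {0} (\<Theta> \<omega>) = 1"
      using * by (simp add: sup_norm_def seq_sup_def nrm_\<Theta>_0)
    moreover have "{0::int..} = {0} \<union> {1..}" by auto
    ultimately have "sup_norm nrm {0..} (\<Theta> \<omega>) = max 1 (?m (\<Theta> \<omega>))"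
      using sup_norm_Un[OF van, of "{0}" "{1..}"] by simp
    then show "1 * ennreal (1 - min 1 (?m (\<Theta> \<omega>) powr \<alpha>)) = K (\<Theta> \<omega>)"
      by (simp add: K_def max_powr_diff)
  qed
  also have "\<dots> = (\<integral>\<^sup>+\<omega>. orbit_sum K (normalized_Y \<omega>) * indicator no_past_exceedance \<omega> \<partial>N)"
    by (rule nn_integral_orbit_sum[OF K hom zero, symmetric])
  also have "\<dots> = (\<integral>\<^sup>+\<omega>. indicator no_past_exceedance \<omega> \<partial>N)"
  proof (rule nn_integral_cong_AE, rule AE_mp[OF good_path], rule AE_I2, rule impI)
    fix \<omega> assume *: "nrm (Y \<omega> 0) > 1 \<and> vanishing nrm (\<Theta> \<omega>) \<and> vanishing nrm (Y \<omega>)"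
    then have pos: "sup_norm nrm UNIV (\<Theta> \<omega>) > 0" using sup_norm_\<Theta>_pos[of \<omega> UNIV] by simp
    have van: "vanishing nrm (normalized_Y \<omega>)" using * by (simp add: normalized_Y_def vanishing_scale)
    have one: "sup_norm nrm UNIV (normalized_Y \<omega>) = 1"
      using * pos by (simp add: normalized_Y_eq_scale_\<Theta> sup_norm_scale)
    define f where "f = (\<lambda>j. sup_norm nrm {j..} (normalized_Y \<omega>) powr \<alpha>)"
    have "K (shift_seq j (normalized_Y \<omega>)) = ennreal (f j - f (j + 1))" for j
      by (simp add: K_def f_def sup_norm_shift add.commute)
    moreover have "(SUP n. \<Sum>j\<in>{-int n..<int n}. ennreal (f j - f (j + 1))) = ennreal (1 - 0)"
    proof (rule SUP_sum_telescope)
      show "f (j + 1) \<le> f j" for j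
        unfolding f_def using \<alpha> by (intro powr_mono2 sup_norm_mono[OF van]) auto
      have "(\<lambda>n. f (- int n)) \<longlonglongrightarrow> 1 powr \<alpha>"
        unfolding f_def one[symmetric] using one
        by (intro tendsto_powr tendsto_const sup_norm_exhaust[OF van]) auto
      then show "(\<lambda>n. f (- int n)) \<longlonglongrightarrow> 1" by simp
      have "(\<lambda>n. f (int n)) \<longlonglongrightarrow> 0 powr \<alpha>"
        unfolding f_def using \<alpha>
        by (intro tendsto_powr' tendsto_const sup_norm_tails[OF van]) auto
      then show "(\<lambda>n. f (int n)) \<longlonglongrightarrow> 0" by simp
    qed
    ultimately have "orbit_sum K (normalized_Y \<omega>) = 1" by (simp add: orbit_sum_def)
    then show "orbit_sum K (normalized_Y \<omega>) * indicator no_past_exceedance \<omega> = indicator no_past_exceedance \<omega>" by simp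
  qed
  also have "\<dots> = ennreal (measure N no_past_exceedance)" by (simp add: N.emeasure_eq_measure)
  finally show ?thesis by (simp add: extremal_index_def)
qed

end

section \<open>Shift invariant homogeneous functionals\<close>

definition front_increment :: "((int \<Rightarrow> 'a::zero) \<Rightarrow> real) \<Rightarrow> (int \<Rightarrow> 'a) \<Rightarrow> real" where
  "front_increment h x = h (future 0 x) - h (future 1 x)"

lemma front_increment_shift:
  assumes "\<And>j x. h (shift_seq j x) = h x"
  shows "front_increment h (shift_seq j x) = h (future j x) - h (future (j + 1) x)"
proof -
  have "future 0 (shift_seq j x) = shift_seq j (future j x)"
    "future 1 (shift_seq j x) = shift_seq j (future (j + 1) x)"
    by (auto simp: future_def shift_seq_def fun_eq_iff)
  then show ?thesis by (simp add: front_increment_def assms)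
qed

lemma front_increment_zero: "x 0 = 0 \<Longrightarrow> front_increment h x = 0"
proof -
  assume "x 0 = 0"
  then have "future 0 x = future 1 x" by (auto simp: future_def fun_eq_iff le_less)
  then show ?thesis by (simp add: front_increment_def)
qed

text \<open>
  A shift invariant functional is the sum of its increments along the orbit. The orbit sums of the
  positive and negative parts are separately finite by hypothesis, so their difference is the limit
  of the telescoping sums over symmetric windows.
\<close>

lemma orbit_sum_front_increment:
  assumes inv: "\<And>j x. h (shift_seq j x) = h x"
    and right: "(\<lambda>n. h (future (int n) x)) \<longlonglongrightarrow> 0"
    and left: "(\<lambda>n. h (future (- int n) x)) \<longlonglongrightarrow> h x"
    and fin: "orbit_sum (\<lambda>x. ennreal (front_increment h x)) x < \<infinity>"
      "orbit_sum (\<lambda>x. ennreal (- front_increment h x)) x < \<infinity>"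
  shows "enn2real (orbit_sum (\<lambda>x. ennreal (front_increment h x)) x)
       - enn2real (orbit_sum (\<lambda>x. ennreal (- front_increment h x)) x) = h x"
proof -
  let ?k = "\<lambda>j. front_increment h (shift_seq j x)"
  let ?J = "\<lambda>n. {-int n..<int n}"
  have lim: "(\<lambda>n. \<Sum>j\<in>?J n. max 0 (f (shift_seq j x))) \<longlonglongrightarrow> enn2real (orbit_sum (\<lambda>x. ennreal (f x)) x)"
    if "orbit_sum (\<lambda>x. ennreal (f x)) x < \<infinity>" for f :: "(int \<Rightarrow> 'a) \<Rightarrow> real"
  proof -
    have "(\<lambda>n. \<Sum>j\<in>?J n. ennreal (f (shift_seq j x))) \<longlonglongrightarrow> orbit_sum (\<lambda>x. ennreal (f x)) x"
      unfolding orbit_sum_def by (rule LIMSEQ_SUP[OF incseq_orbit_partial[of "\<lambda>x. ennreal (f x)"]])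
    also have "(\<lambda>n. \<Sum>j\<in>?J n. ennreal (f (shift_seq j x))) = (\<lambda>n. ennreal (\<Sum>j\<in>?J n. max 0 (f (shift_seq j x))))"
      by (simp add: sum_ennreal[symmetric] ennreal_max_0')
    finally have *: "(\<lambda>n. ennreal (\<Sum>j\<in>?J n. max 0 (f (shift_seq j x)))) \<longlonglongrightarrow> orbit_sum (\<lambda>x. ennreal (f x)) x" .
    have "(\<lambda>n. enn2real (ennreal (\<Sum>j\<in>?J n. max 0 (f (shift_seq j x))))) \<longlonglongrightarrow> enn2real (orbit_sum (\<lambda>x. ennreal (f x)) x)"
      by (rule tendsto_enn2real) (use * that in simp_all)
    then show ?thesis by (simp add: sum_nonneg)
  qed
  have "(\<lambda>n. (\<Sum>j\<in>?J n. max 0 (?k j)) - (\<Sum>j\<in>?J n. max 0 (- ?k j)))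
      \<longlonglongrightarrow> enn2real (orbit_sum (\<lambda>x. ennreal (front_increment h x)) x)
       - enn2real (orbit_sum (\<lambda>x. ennreal (- front_increment h x)) x)"
    by (intro tendsto_diff lim fin)
  moreover have "(\<Sum>j\<in>?J n. max 0 (?k j)) - (\<Sum>j\<in>?J n. max 0 (- ?k j))
      = h (future (- int n) x) - h (future (int n) x)" for n
  proof -
    have "(\<Sum>j\<in>?J n. max 0 (?k j)) - (\<Sum>j\<in>?J n. max 0 (- ?k j)) = (\<Sum>j\<in>?J n. ?k j)"
      unfolding sum_subtractf[symmetric] by (rule sum.cong) (auto simp: max_def)
    also have "\<dots> = (\<Sum>j\<in>?J n. h (future j x) - h (future (j + 1) x))"
      by (simp add: front_increment_shift[OF inv])
    also have "\<dots> = h (future (- int n) x) - h (future (int n) x)"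
      by (rule sum_telescope_symmetric)
    finally show ?thesis .
  qed
  moreover have "(\<lambda>n. h (future (- int n) x) - h (future (int n) x)) \<longlonglongrightarrow> h x - 0"
    by (intro tendsto_diff left right)
  ultimately show ?thesis using LIMSEQ_unique by fastforce
qed

lemma shift_invariant_on_shift_seq:
  assumes "shift_invariant_on D H"
  shows "shift_seq j x \<in> D \<longleftrightarrow> x \<in> D" "x \<in> D \<Longrightarrow> H (shift_seq j x) = H x"
proof -
  have pred_shift: "shift_seq (i - 1) x = backshift (shift_seq i x)" for i
    by (simp add: shift_seq_def backshift_def algebra_simps)
  have inv: "backshift y \<in> D \<longleftrightarrow> y \<in> D" "y \<in> D \<Longrightarrow> H (backshift y) = H y" for y
    using assms by (auto simp: shift_invariant_on_def)
  have "(shift_seq j x \<in> D \<longleftrightarrow> x \<in> D) \<and> (x \<in> D \<longrightarrow> H (shift_seq j x) = H x)"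
  proof (induction j rule: int_induct[where k = 0])
    case base
    then show ?case by (simp add: shift_seq_def)
  next
    case (step1 i)
    have "shift_seq i x = backshift (shift_seq (i + 1) x)" using pred_shift[of "i + 1"] by simp
    then show ?case using step1 inv[of "shift_seq (i + 1) x"] by metis
  next
    case (step2 i)
    then show ?case using pred_shift[of i] inv[of "shift_seq i x"] by metis
  qed
  then show "shift_seq j x \<in> D \<longleftrightarrow> x \<in> D" "x \<in> D \<Longrightarrow> H (shift_seq j x) = H x" by auto
qed

lemma future_scale: "future n (seq_scale c x) = seq_scale c (future n x)"
  by (auto simp: future_def seq_scale_def fun_eq_iff)

lemma measurable_future [measurable (raw)]:
  fixes f :: "'b \<Rightarrow> int \<Rightarrow> 'a::euclidean_space"
  assumes "f \<in> borel_measurable M"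
  shows "(\<lambda>x. future n (f x)) \<in> borel_measurable M"
  unfolding future_def
proof (rule measurable_coordinatewise_then_product)
  fix i
  show "(\<lambda>x. if n \<le> i then f x i else 0) \<in> borel_measurable M"
    using measurable_product_then_coordinatewise[OF assms, of i] by simp
qed

lemma integral_enn2real_finite:
  assumes [measurable]: "f \<in> borel_measurable M" and fin: "(\<integral>\<^sup>+x. f x \<partial>M) < \<infinity>"
  shows "integrable M (\<lambda>x. enn2real (f x))" "(LINT x|M. enn2real (f x)) = enn2real (\<integral>\<^sup>+x. f x \<partial>M)"
    "AE x in M. f x < \<infinity>"
proof -
  have "AE x in M. f x \<noteq> \<infinity>" by (rule nn_integral_noteq_infinite) (use fin in auto)
  then show fin': "AE x in M. f x < \<infinity>" by eventually_elim (simp add: top.not_eq_extremum)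
  have eq: "(\<integral>\<^sup>+x. ennreal (enn2real (f x)) \<partial>M) = (\<integral>\<^sup>+x. f x \<partial>M)"
    by (rule nn_integral_cong_AE, rule AE_mp[OF fin'], rule AE_I2) auto
  show "integrable M (\<lambda>x. enn2real (f x))"
    by (rule integrableI_nonneg) (use eq fin in auto)
  show "(LINT x|M. enn2real (f x)) = enn2real (\<integral>\<^sup>+x. f x \<partial>M)"
    by (subst integral_eq_nn_integral) (use eq in auto)
qed

context vanishing_tail_process
begin

context
  fixes R :: "'q measure" and Q :: "'q \<Rightarrow> int \<Rightarrow> 'a"
  assumes R: "prob_space R" and Q [measurable]: "Q \<in> borel_measurable R"
    and Q_distr: "distr R borel Q = Q_law nrm N Y"
begin

lemma distr_Q: "distr R borel Q = distr (uniform_measure N no_past_exceedance) borel normalized_Y"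
  unfolding Q_distr Q_law_def no_past_exceedance_def normalized_Y_def[abs_def] sup_norm_def ..

text \<open>
  Otherwise the conditional law defining \<open>Q\<close> would be the zero measure, and not the law of a random
  sequence.
\<close>

lemma no_past_exceedance_pos: "measure N no_past_exceedance > 0"
proof (rule ccontr)
  assume "\<not> measure N no_past_exceedance > 0"
  then have "emeasure N no_past_exceedance = 0" by (simp add: N.emeasure_eq_measure zero_less_measure_iff)
  then have "emeasure (uniform_measure N no_past_exceedance) (space N) = 0"
    by (metis no_past_exceedance_sets Int_lower1 divide_ennreal_def emeasure_eq_0 emeasure_uniform_measure mult_zero_left sets.top)
  moreover have "emeasure (uniform_measure N no_past_exceedance) (space N) = emeasure R (space R)"
    using arg_cong[OF distr_Q, of "\<lambda>\<mu>. emeasure \<mu> UNIV"] by (simp add: emeasure_distr)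
  ultimately show False using prob_space.emeasure_space_1[OF R] by simp
qed

lemma nn_integral_Q:
  assumes [measurable]: "f \<in> borel_measurable borel"
  shows "ennreal (measure N no_past_exceedance) * (\<integral>\<^sup>+\<omega>. f (Q \<omega>) \<partial>R) = (\<integral>\<^sup>+\<omega>. f (normalized_Y \<omega>) * indicator no_past_exceedance \<omega> \<partial>N)"
proof -
  have "(\<integral>\<^sup>+\<omega>. f (Q \<omega>) \<partial>R) = (\<integral>\<^sup>+x. f x \<partial>distr R borel Q)"
    by (simp add: nn_integral_distr)
  also have "\<dots> = (\<integral>\<^sup>+\<omega>. f (normalized_Y \<omega>) \<partial>uniform_measure N no_past_exceedance)"
    unfolding distr_Q by (simp add: nn_integral_distr)
  also have "\<dots> = (\<integral>\<^sup>+\<omega>. f (normalized_Y \<omega>) * indicator no_past_exceedance \<omega> \<partial>N) / ennreal (measure N no_past_exceedance)"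
    by (simp add: nn_integral_uniform_measure N.emeasure_eq_measure)
  finally show ?thesis
    using no_past_exceedance_pos
    by (simp add: ennreal_times_divide mult.commute[of "ennreal (measure N no_past_exceedance)"] mult_divide_eq_ennreal)
qed

lemma AE_Q:
  assumes [measurable]: "Measurable.pred borel P" and "AE \<omega> in N. P (normalized_Y \<omega>)"
  shows "AE \<omega> in R. P (Q \<omega>)"
proof -
  have "AE \<omega> in uniform_measure N no_past_exceedance. P (normalized_Y \<omega>)"
    using assms(2) by (intro AE_uniform_measureI) auto
  then have "AE x in distr R borel Q. P x"
    unfolding distr_Q by (subst AE_distr_iff) simp_all
  then show ?thesis by (subst (asm) AE_distr_iff) simp_all
qed

text \<open>
  The core of the result, for functionals defined on all sequences: the orbit sum identity is
  applied to the positive and the negative part of the increment, whose orbit sums have difference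
  \<open>h\<close> at \<open>Q\<close>. Integrability of the increment makes both orbit sums finite almost surely.
\<close>

lemma expectation_shift_invariant_functional:
  fixes h :: "(int \<Rightarrow> 'a) \<Rightarrow> real"
  assumes h [measurable]: "h \<in> borel_measurable borel"
    and inv: "\<And>j x. h (shift_seq j x) = h x"
    and hom: "\<And>c x. c > 0 \<Longrightarrow> h (seq_scale c x) = c powr \<alpha> * h x"
    and int: "integrable N (\<lambda>\<omega>. front_increment h (\<Theta> \<omega>))"
    and right: "AE \<omega> in N. (\<lambda>n. h (future (int n) (\<Theta> \<omega>))) \<longlonglongrightarrow> 0"
    and left: "AE \<omega> in N. (\<lambda>n. h (future (- int n) (\<Theta> \<omega>))) \<longlonglongrightarrow> h (\<Theta> \<omega>)"
  shows "integrable R (\<lambda>\<omega>. h (Q \<omega>))"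
    and "extremal_index nrm N Y * (LINT \<omega>|R. h (Q \<omega>)) = (LINT \<omega>|N. front_increment h (\<Theta> \<omega>))"
proof -
  let ?k = "front_increment h"
  have [measurable]: "?k \<in> borel_measurable borel"
    unfolding front_increment_def[abs_def] by measurable
  have k_hom: "?k (seq_scale c x) = c powr \<alpha> * ?k x" if "c > 0" for c x
    by (simp add: front_increment_def future_scale hom[OF that] right_diff_distrib)
  \<comment> \<open>The signs \<open>\<epsilon> = 1\<close> and \<open>\<epsilon> = -1\<close> select the positive and the negative part.\<close>
  define S where "S = (\<lambda>\<epsilon>::real. orbit_sum (\<lambda>x. ennreal (\<epsilon> * ?k x)))"
  have [measurable]: "S \<epsilon> \<in> borel_measurable borel" for \<epsilon> unfolding S_def by measurable
  let ?\<theta> = "measure N no_past_exceedance"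
  have S: "ennreal ?\<theta> * (\<integral>\<^sup>+\<omega>. S \<epsilon> (Q \<omega>) \<partial>R) = (\<integral>\<^sup>+\<omega>. ennreal (\<epsilon> * ?k (\<Theta> \<omega>)) \<partial>N)" for \<epsilon>
  proof -
    have "ennreal ?\<theta> * (\<integral>\<^sup>+\<omega>. S \<epsilon> (Q \<omega>) \<partial>R) = (\<integral>\<^sup>+\<omega>. S \<epsilon> (normalized_Y \<omega>) * indicator no_past_exceedance \<omega> \<partial>N)"
      by (rule nn_integral_Q) measurable
    also have "\<dots> = (\<integral>\<^sup>+\<omega>. ennreal (\<epsilon> * ?k (\<Theta> \<omega>)) \<partial>N)"
      unfolding S_def
      by (rule nn_integral_orbit_sum)
         (simp_all add: k_hom front_increment_zero mult.left_commute[of \<epsilon>] flip: ennreal_mult')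
    finally show ?thesis .
  qed
  have fin: "(\<integral>\<^sup>+\<omega>. S \<epsilon> (Q \<omega>) \<partial>R) < \<infinity>" if "\<epsilon> \<in> {1, -1}" for \<epsilon>
  proof -
    have "ennreal ?\<theta> * (\<integral>\<^sup>+\<omega>. S \<epsilon> (Q \<omega>) \<partial>R) < \<infinity>"
      unfolding S using int that by (auto simp: real_integrable_def top.not_eq_extremum)
    then show ?thesis
      using no_past_exceedance_pos by (auto simp: ennreal_mult_less_top)
  qed
  have "AE \<omega> in N. S 1 (normalized_Y \<omega>) < \<infinity> \<longrightarrow> S (-1) (normalized_Y \<omega>) < \<infinity> \<longrightarrow> enn2real (S 1 (normalized_Y \<omega>)) - enn2real (S (-1) (normalized_Y \<omega>)) = h (normalized_Y \<omega>)"
    using good_path right left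
  proof eventually_elim
    case (elim \<omega>)
    define c where "c = 1 / sup_norm nrm UNIV (\<Theta> \<omega>)"
    have c: "c > 0" using elim(1) sup_norm_\<Theta>_pos[of \<omega> UNIV] by (simp add: c_def)
    have Z_eq: "normalized_Y \<omega> = seq_scale c (\<Theta> \<omega>)" using elim(1) by (simp add: normalized_Y_eq_scale_\<Theta> c_def)
    have "(\<lambda>n. h (future (int n) (normalized_Y \<omega>))) \<longlonglongrightarrow> 0"
      unfolding Z_eq future_scale hom[OF c] using elim(2) by (rule tendsto_mult_right_zero)
    moreover have "(\<lambda>n. h (future (- int n) (normalized_Y \<omega>))) \<longlonglongrightarrow> h (normalized_Y \<omega>)"
      unfolding Z_eq future_scale hom[OF c] using elim(3) by (intro tendsto_mult tendsto_const)
    ultimately show ?case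
      using orbit_sum_front_increment[of h, OF inv] by (simp add: S_def)
  qed
  moreover have [measurable]: "Measurable.pred borel (\<lambda>x. enn2real (S 1 x) - enn2real (S (-1) x) = h x)"
    unfolding pred_def by (rule borel_measurable_eq) measurable
  ultimately have "AE \<omega> in R. S 1 (Q \<omega>) < \<infinity> \<longrightarrow> S (-1) (Q \<omega>) < \<infinity> \<longrightarrow> enn2real (S 1 (Q \<omega>)) - enn2real (S (-1) (Q \<omega>)) = h (Q \<omega>)"
    by (intro AE_Q) measurable
  moreover have "AE \<omega> in R. S \<epsilon> (Q \<omega>) < \<infinity>" if "\<epsilon> \<in> {1, -1}" for \<epsilon>
    by (rule integral_enn2real_finite(3)) (use fin that in auto)
  from this[of 1] this[of "-1"] have "AE \<omega> in R. S 1 (Q \<omega>) < \<infinity>" "AE \<omega> in R. S (-1) (Q \<omega>) < \<infinity>" by auto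
  ultimately have h_eq: "AE \<omega> in R. enn2real (S 1 (Q \<omega>)) - enn2real (S (-1) (Q \<omega>)) = h (Q \<omega>)"
    by eventually_elim simp
  have I: "integrable R (\<lambda>\<omega>. enn2real (S \<epsilon> (Q \<omega>)))"
    "?\<theta> * (LINT \<omega>|R. enn2real (S \<epsilon> (Q \<omega>))) = enn2real (\<integral>\<^sup>+\<omega>. ennreal (\<epsilon> * ?k (\<Theta> \<omega>)) \<partial>N)"
    if "\<epsilon> \<in> {1, -1}" for \<epsilon>
  proof -
    show "integrable R (\<lambda>\<omega>. enn2real (S \<epsilon> (Q \<omega>)))"
      by (rule integral_enn2real_finite(1)) (use fin[OF that] in auto)
    have "(LINT \<omega>|R. enn2real (S \<epsilon> (Q \<omega>))) = enn2real (\<integral>\<^sup>+\<omega>. S \<epsilon> (Q \<omega>) \<partial>R)"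
      by (rule integral_enn2real_finite(2)) (use fin[OF that] in auto)
    then show "?\<theta> * (LINT \<omega>|R. enn2real (S \<epsilon> (Q \<omega>))) = enn2real (\<integral>\<^sup>+\<omega>. ennreal (\<epsilon> * ?k (\<Theta> \<omega>)) \<partial>N)"
      using arg_cong[OF S[of \<epsilon>], of enn2real] by (simp add: enn2real_mult)
  qed
  have diff: "integrable R (\<lambda>\<omega>. enn2real (S 1 (Q \<omega>)) - enn2real (S (-1) (Q \<omega>)))"
    by (intro Bochner_Integration.integrable_diff I) auto
  show "integrable R (\<lambda>\<omega>. h (Q \<omega>))"
    by (rule integrable_cong_AE_imp[OF diff]) (use h_eq in \<open>auto simp: eq_commute\<close>)
  have "(LINT \<omega>|R. h (Q \<omega>)) = (LINT \<omega>|R. enn2real (S 1 (Q \<omega>)) - enn2real (S (-1) (Q \<omega>)))"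
    by (rule integral_cong_AE) (use h_eq in \<open>auto simp: eq_commute\<close>)
  also have "\<dots> = (LINT \<omega>|R. enn2real (S 1 (Q \<omega>))) - (LINT \<omega>|R. enn2real (S (-1) (Q \<omega>)))"
    by (intro Bochner_Integration.integral_diff I) auto
  finally have "?\<theta> * (LINT \<omega>|R. h (Q \<omega>))
      = enn2real (\<integral>\<^sup>+\<omega>. ennreal (?k (\<Theta> \<omega>)) \<partial>N) - enn2real (\<integral>\<^sup>+\<omega>. ennreal (- ?k (\<Theta> \<omega>)) \<partial>N)"
    using I(2)[of 1] I(2)[of "-1"] by (simp add: right_diff_distrib)
  then show "extremal_index nrm N Y * (LINT \<omega>|R. h (Q \<omega>)) = (LINT \<omega>|N. ?k (\<Theta> \<omega>))"
    unfolding extremal_index_eq real_lebesgue_integral_def[OF int] .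
qed

end
end

theorem lemma3p8:
  fixes nrm :: "real ^ 'd \<Rightarrow> real"
    and \<alpha> :: real
    and M :: "'w measure" and X :: "'w \<Rightarrow> int \<Rightarrow> real ^ 'd"
    and N :: "'v measure" and Y :: "'v \<Rightarrow> int \<Rightarrow> real ^ 'd"
    and R :: "'q measure" and Q :: "'q \<Rightarrow> int \<Rightarrow> real ^ 'd"
    and D :: "(int \<Rightarrow> real ^ 'd) set" and H :: "(int \<Rightarrow> real ^ 'd) \<Rightarrow> real"
  defines "\<Theta> \<equiv> \<lambda>\<omega>. spectral nrm (Y \<omega>)"
  assumes "is_norm nrm"
    and "prob_space M" and "X \<in> borel_measurable M"
    and "stationary M X" and "regularly_varying nrm M X"
    and "\<alpha> > 0" and "tail_index nrm M X \<alpha>"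
    and "prob_space N" and "Y \<in> borel_measurable N" and "tail_process nrm \<alpha> M X N Y"
    and "prob_space R" and "Q \<in> borel_measurable R" and "distr R borel Q = Q_law nrm N Y"
    and "AE \<omega> in N. ((\<lambda>j. nrm (Y \<omega> j)) \<longlongrightarrow> 0) (filtercomap abs at_top)"
    and "D \<in> sets borel" and "D \<subseteq> ell nrm \<alpha>"
    and "H \<in> borel_measurable (restrict_space borel D)" and "H \<in> extensional D"
    and "shift_invariant_on D H" and "homogeneous_on \<alpha> D H"
    and "\<And>n. AE \<omega> in N. future n (\<Theta> \<omega>) \<in> D"
    and "integrable N (\<lambda>\<omega>. H (future 0 (\<Theta> \<omega>)) - H (future 1 (\<Theta> \<omega>)))"
    and "AE \<omega> in N. (\<lambda>n::nat. H (future (int n) (\<Theta> \<omega>))) \<longlonglongrightarrow> 0"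
    and "AE \<omega> in N. \<Theta> \<omega> \<in> D \<and> (\<lambda>n::nat. H (future (- int n) (\<Theta> \<omega>))) \<longlonglongrightarrow> H (\<Theta> \<omega>)"
  shows "integrable R (\<lambda>\<omega>. H (Q \<omega>)) \<and>
         extremal_index nrm N Y * (LINT \<omega>|R. H (Q \<omega>)) =
           (LINT \<omega>|N. H (future 0 (\<Theta> \<omega>)) - H (future 1 (\<Theta> \<omega>)))"
proof -
  note D = \<open>D \<in> sets borel\<close> and H_meas = \<open>H \<in> borel_measurable (restrict_space borel D)\<close>
    and H_ext = \<open>H \<in> extensional D\<close> and H_hom = \<open>homogeneous_on \<alpha> D H\<close>
    and Y = \<open>Y \<in> borel_measurable N\<close> and Q = \<open>Q \<in> borel_measurable R\<close>
    and future_D = \<open>\<And>n. AE \<omega> in N. future n (\<Theta> \<omega>) \<in> D\<close>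
  note [measurable] = D Y Q
  interpret T: vanishing_tail_process nrm \<alpha> M X N Y
    using assms by (auto simp: vanishing_tail_process_def vanishing_tail_process_axioms_def
        tail_process_of_stationary_def vanishing_def)
  have \<Theta> [measurable]: "\<Theta> \<in> borel_measurable N"
    unfolding \<Theta>_def by measurable
  \<comment> \<open>Extension by \<open>0\<close>, unlike the extension by \<open>undefined\<close>, stays homogeneous off \<open>D\<close>.\<close>
  define h where "h = (\<lambda>x. if x \<in> D then H x else 0)"
  have "(\<lambda>x. indicator D x *\<^sub>R H x) \<in> borel_measurable borel"
    using H_meas D by (subst (asm) borel_measurable_restrict_space_iff) auto
  then have h [measurable]: "h \<in> borel_measurable borel"
    unfolding h_def by (rule measurable_cong[THEN iffD1, rotated]) simp
  have "H = (\<lambda>x. if x \<in> D then h x else undefined)"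
    using H_ext by (auto simp: h_def extensional_def fun_eq_iff)
  then have H [measurable]: "H \<in> borel_measurable borel"
    by (rule ssubst) measurable
  have inv: "h (shift_seq j x) = h x" for j x
    using shift_invariant_on_shift_seq[OF \<open>shift_invariant_on D H\<close>, where j = j and x = x] by (simp add: h_def)
  have hom: "h (seq_scale c x) = c powr \<alpha> * h x" if "c > 0" for c x
    using H_hom that unfolding homogeneous_on_def h_def by simp
  have in_D: "AE \<omega> in N. \<forall>n. future n (\<Theta> \<omega>) \<in> D"
    using future_D by (simp add: AE_all_countable)
  have incr: "AE \<omega> in N. H (future 0 (\<Theta> \<omega>)) - H (future 1 (\<Theta> \<omega>)) = front_increment h (\<Theta> \<omega>)"
    using in_D by eventually_elim (simp add: front_increment_def h_def)
  have incr_meas [measurable]: "(\<lambda>\<omega>. front_increment h (\<Theta> \<omega>)) \<in> borel_measurable N"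
    unfolding front_increment_def by measurable
  have "integrable N (\<lambda>\<omega>. front_increment h (\<Theta> \<omega>))"
    by (rule integrable_cong_AE_imp[OF \<open>integrable N (\<lambda>\<omega>. H (future 0 (\<Theta> \<omega>)) - H (future 1 (\<Theta> \<omega>)))\<close>])
       (use incr in auto)
  moreover have "AE \<omega> in N. (\<lambda>n. h (future (int n) (\<Theta> \<omega>))) \<longlonglongrightarrow> 0"
    using in_D \<open>AE \<omega> in N. (\<lambda>n::nat. H (future (int n) (\<Theta> \<omega>))) \<longlonglongrightarrow> 0\<close>
    by eventually_elim (simp add: h_def)
  moreover have left: "AE \<omega> in N. \<Theta> \<omega> \<in> D \<and> (\<lambda>n. h (future (- int n) (\<Theta> \<omega>))) \<longlonglongrightarrow> h (\<Theta> \<omega>)"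
    using in_D \<open>AE \<omega> in N. \<Theta> \<omega> \<in> D \<and> (\<lambda>n::nat. H (future (- int n) (\<Theta> \<omega>))) \<longlonglongrightarrow> H (\<Theta> \<omega>)\<close>
    by eventually_elim (simp add: h_def)
  ultimately have main: "integrable R (\<lambda>\<omega>. h (Q \<omega>))"
    "extremal_index nrm N Y * (LINT \<omega>|R. h (Q \<omega>)) = (LINT \<omega>|N. front_increment h (\<Theta> \<omega>))"
    using T.expectation_shift_invariant_functional[OF \<open>prob_space R\<close> Q \<open>distr R borel Q = Q_law nrm N Y\<close> h inv hom]
    unfolding \<Theta>_def by auto
  have "AE \<omega> in N. T.normalized_Y \<omega> \<in> D"
    using T.good_path left
  proof eventually_elim
    case (elim \<omega>)
    then have "1 / sup_norm nrm UNIV (\<Theta> \<omega>) > 0"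
      using T.sup_norm_\<Theta>_pos[of \<omega> UNIV] by (simp add: \<Theta>_def)
    then show ?case
      using elim H_hom by (simp add: T.normalized_Y_eq_scale_\<Theta> homogeneous_on_def \<Theta>_def)
  qed
  then have Q_D: "AE \<omega> in R. Q \<omega> \<in> D"
    by (rule T.AE_Q[OF \<open>prob_space R\<close> Q \<open>distr R borel Q = Q_law nrm N Y\<close>, rotated]) measurable
  then have H_eq: "AE \<omega> in R. h (Q \<omega>) = H (Q \<omega>)"
    by eventually_elim (simp add: h_def)
  have "integrable R (\<lambda>\<omega>. H (Q \<omega>))"
    by (rule integrable_cong_AE_imp[OF main(1)]) (use H_eq in auto)
  moreover have "(LINT \<omega>|R. H (Q \<omega>)) = (LINT \<omega>|R. h (Q \<omega>))"
    by (rule integral_cong_AE) (use H_eq in auto)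
  moreover have "(LINT \<omega>|N. H (future 0 (\<Theta> \<omega>)) - H (future 1 (\<Theta> \<omega>))) = (LINT \<omega>|N. front_increment h (\<Theta> \<omega>))"
    by (rule integral_cong_AE) (use incr in auto)
  ultimately show ?thesis using main(2) by simp
qed

end
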